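(* Let $r,n\in\mathbb{N}$, let $c_1,\ldots,c_r\in\mathbb{R}$ with $c_k\ne c_l$ for $k\neq l$, let $j=\mathrm{diag}\{I_{m_1},-I_{m_2}\}$ with $m_1,m_2\in\mathbb{N}\cup\{0\}$, $m=m_1+m_2>0$, and let $\beta_k(x)\in\mathbb{C}^{p\times m}$ ($1\le k\le r$, $p\le m$) be matrix functions on an interval $\mathcal I$ with $0\in\mathcal I$ such that the Hamiltonians $H_k(x)=\beta_k(x)^*\beta_k(x)$ are locally summable. Let the initial generalised Hamiltonian system $$y'(x,z)=G(x,z)y(x,z),\qquad G(x,z)=\mathrm{i}\sum_{k=1}^r(z-c_k)^{-1}jH_k(x),\qquad x\in\mathcal I,$$ and a triple of matrices $\{A,S(0),\Pi(0)\}$ be given, where $A,S(0)\in\mathbb{C}^{n\times n}$, $\Pi(0)\in\mathbb{C}^{n\times m}$, $c_k\notin\sigma(A)$ for $1\le k\le r$, and $$AS(0)-S(0)A^*=\mathrm{i}\,\Pi(0)j\Pi(0)^*,\qquad S(0)=S(0)^*.$$ Let $\Pi(x)$ and $S(x)$ be determined by these initial values and by $$\Pi'(x)=-\mathrm{i}\sum_{k=1}^r(A-c_kI_n)^{-1}\Pi(x)jH_k(x),$$ $$S'(x)=-\sum_{k=1}^r(A-c_kI_n)^{-1}\Pi(x)jH_k(x)j\Pi(x)^*(A^*-c_kI_n)^{-1},$$ and put $$w_A(x,z)=I_m-\mathrm{i}\,j\Pi(x)^*S(x)^{-1}(A-zI_n)^{-1}\Pi(x).$$ Then, at the points of invertibility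 of $S(x)$: (i) the GBDT-transformed generalised Hamiltonian system (defined in the context) is given by $$\widetilde y'(x,z)=\widetilde G(x,z)\widetilde y(x,z),\qquad \widetilde G(x,z)=\mathrm{i}\sum_{k=1}^r(z-c_k)^{-1}j\widetilde H_k(x),$$ $$\widetilde H_k(x)=\widetilde\beta_k(x)^*\widetilde\beta_k(x),\qquad \widetilde\beta_k(x)=\beta_k(x)\,j\,w_A(x,c_k)^*j;$$ (ii) $w_A(x,z)$ is the corresponding Darboux matrix (defined in the context); in particular, $$w_A'(x,z)=\widetilde G(x,z)w_A(x,z)-w_A(x,z)G(x,z).$$ (iii) If $S(x)$ is invertible on the interval $\mathcal I$ where the systems are considered, and $w(x,z)$ is a fundamental solution of the initial system, then the fundamental solution $\widetilde w(x,z)$ of the transformed system has the form $$\widetilde w(x,z)=w_A(x,z)w(x,z).$$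
   Context: Here $'$ denotes $d/dx$, $z$ is the complex spectral parameter, $I_q$ is the $q\times q$ identity matrix, $M^*$ is the conjugate transpose of $M$, and $\sigma(A)$ is the spectrum of $A$. A fundamental solution is a nondegenerate $m\times m$ matrix solution. GBDT-transformed system (generalised Bäcklund–Darboux transformation determined by the triple $\{A,S(0),\Pi(0)\}$): with $$X_{k,-1}=\mathrm{i}\,j\Pi^*S^{-1}(A-c_kI_n)^{-1}\Pi,\qquad Y_{k,-1}=\mathrm{i}\,j\Pi^*(A^*-c_kI_n)^{-1}S^{-1}\Pi,$$ it is the system $\widetilde y'=\mathrm{i}\sum_{k=1}^r(z-c_k)^{-1}j\widetilde H_k\widetilde y$ with $$\widetilde H_k=H_k+H_kY_{k,-1}-jX_{k,-1}jH_k-jX_{k,-1}jH_kY_{k,-1}=(I_m-jX_{k,-1}j)H_k(I_m+Y_{k,-1}).$$ A Darboux matrix for an initial system $y'=Gy$ and a transformed system $\widetilde y'=\widetilde G\widetilde y$ is a nondegenerate matrix function $W(x,z)$ satisfying $W'=\widetilde GW-WG$.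
   Formalization: Nondegeneracy of w_A in (ii) and all of (iii) are stated for z outside the spectrum of A* (besides σ(A) and the c_k): since det w_A = det(A*-z)/det(A-z), w_A is degenerate at eigenvalues of A*, where these claims fail. *)

theory Defs
  imports "HOL-Analysis.Analysis"
begin

definition cmat_scale :: "complex \<Rightarrow> complex^'b^'a \<Rightarrow> complex^'b^'a" (infixr "*\<^sub>m" 75)
  where "a *\<^sub>m M = (\<chi> i l. a * M $ i $ l)"

definition ctranspose :: "complex^'b^'a \<Rightarrow> complex^'a^'b"
  where "ctranspose M = (\<chi> i l. cnj (M $ l $ i))"

definition mat_spectrum :: "complex^'n^'n \<Rightarrow> complex set"
  where "mat_spectrum A = {z. \<not> invertible (A - mat z)}"

definition resolvent :: "complex^'n^'n \<Rightarrow> complex \<Rightarrow> complex^'n^'n"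
  where "resolvent A z = matrix_inv (A - mat z)"

text \<open>The matrix \<open>diag {I, - I}\<close> with blocks of sizes \<open>m1\<close> and \<open>CARD('m) - m1\<close>. The (zero-based)
  position of an index \<open>a\<close> is the number of indices below it, so that either block may be empty.\<close>

definition signature_mat :: "nat \<Rightarrow> complex^'m::{finite,linorder}^'m::{finite,linorder}"
  where "signature_mat m1 =
    (\<chi> a b. if a = b then (if card {d. d < a} < m1 then 1 else - 1) else 0)"

text \<open>Coefficients are only locally summable, so differential equations are understood in the
  Caratheodory sense: solutions are locally absolutely continuous and satisfy the equation almost
  everywhere. The sets \<open>X\<close> below are intervals or relatively open subsets of intervals.\<close>

definition abs_continuous :: "real \<Rightarrow> real \<Rightarrow> (real \<Rightarrow> 'a::real_normed_vector) \<Rightarrow> bool"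
  where "abs_continuous a b f \<longleftrightarrow>
    (\<forall>\<epsilon>>0. \<exists>\<delta>>0. \<forall>(N::nat) u v.
      (\<forall>i<N. a \<le> u i \<and> u i \<le> v i \<and> v i \<le> b) \<and>
      (\<forall>i<N. \<forall>l<N. i \<noteq> l \<longrightarrow> {u i<..<v i} \<inter> {u l<..<v l} = {}) \<and>
      (\<Sum>i<N. v i - u i) < \<delta>
      \<longrightarrow> (\<Sum>i<N. norm (f (v i) - f (u i))) < \<epsilon>)"

definition locally_abs_continuous :: "real set \<Rightarrow> (real \<Rightarrow> 'a::real_normed_vector) \<Rightarrow> bool"
  where "locally_abs_continuous X f \<longleftrightarrow> (\<forall>a b. a \<le> b \<and> {a..b} \<subseteq> X \<longrightarrow> abs_continuous a b f)"

definition locally_summable :: "real set \<Rightarrow> (real \<Rightarrow> 'a::euclidean_space) \<Rightarrow> bool"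
  where "locally_summable X f \<longleftrightarrow>
    (\<forall>a b. a \<le> b \<and> {a..b} \<subseteq> X \<longrightarrow> f absolutely_integrable_on {a..b})"

definition has_ae_derivative_on ::
    "(real \<Rightarrow> 'a::real_normed_vector) \<Rightarrow> (real \<Rightarrow> 'a) \<Rightarrow> real set \<Rightarrow> bool"
  where "has_ae_derivative_on f f' X \<longleftrightarrow>
    locally_abs_continuous X f \<and>
    (AE x\<in>X in lebesgue. (f has_vector_derivative f' x) (at x within X))"

definition hamiltonians ::
    "nat \<Rightarrow> real set \<Rightarrow> (nat \<Rightarrow> real \<Rightarrow> complex^'m^'p) \<Rightarrow> (nat \<Rightarrow> real \<Rightarrow> complex^'m^'m) \<Rightarrow> bool"
  where "hamiltonians r X \<beta> H \<longleftrightarrow>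
    (\<forall>k\<in>{1..r}. (\<forall>x\<in>X. H k x = ctranspose (\<beta> k x) ** \<beta> k x) \<and> locally_summable X (H k))"

definition system_coeff ::
    "nat \<Rightarrow> (nat \<Rightarrow> real) \<Rightarrow> complex^'m^'m \<Rightarrow> (nat \<Rightarrow> real \<Rightarrow> complex^'m^'m) \<Rightarrow>
     real \<Rightarrow> complex \<Rightarrow> complex^'m^'m"
  where "system_coeff r c j H x z =
    \<i> *\<^sub>m (\<Sum>k=1..r. inverse (z - of_real (c k)) *\<^sub>m (j ** H k x))"

definition fundamental_solution ::
    "real set \<Rightarrow> (real \<Rightarrow> complex^'m^'m) \<Rightarrow> (real \<Rightarrow> complex^'m^'m) \<Rightarrow> bool"
  where "fundamental_solution X G w \<longleftrightarrow>
    has_ae_derivative_on w (\<lambda>x. G x ** w x) X \<and> (\<forall>x\<in>X. invertible (w x))"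

text \<open>\<open>Z\<close> is the set of admissible values of the spectral parameter. For the matrix function
  \<open>w_transfer\<close> below, \<open>det w(x,z) = det (A\<^sup>* - z) / det (A - z)\<close>, so the eigenvalues of the conjugate
  transpose of \<open>A\<close> have to be left out of \<open>Z\<close>.\<close>

definition darboux_matrix ::
    "real set \<Rightarrow> complex set \<Rightarrow> (real \<Rightarrow> complex \<Rightarrow> complex^'m^'m) \<Rightarrow>
     (real \<Rightarrow> complex \<Rightarrow> complex^'m^'m) \<Rightarrow> (real \<Rightarrow> complex \<Rightarrow> complex^'m^'m) \<Rightarrow> bool"
  where "darboux_matrix X Z G Gt W \<longleftrightarrow>
    (\<forall>z\<in>Z. (\<forall>x\<in>X. invertible (W x z)) \<and>
      has_ae_derivative_on (\<lambda>x. W x z) (\<lambda>x. Gt x z ** W x z - W x z ** G x z) X)"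

text \<open>The functions \<open>\<Pi>(x)\<close> and \<open>S(x)\<close> of the transformation are called \<open>P\<close> and \<open>S\<close>.\<close>

definition gbdt_triple ::
    "nat \<Rightarrow> (nat \<Rightarrow> real) \<Rightarrow> complex^'m^'m \<Rightarrow> (nat \<Rightarrow> real \<Rightarrow> complex^'m^'m) \<Rightarrow> real set \<Rightarrow>
     complex^'n^'n \<Rightarrow> (real \<Rightarrow> complex^'n^'n) \<Rightarrow> (real \<Rightarrow> complex^'m^'n) \<Rightarrow> bool"
  where "gbdt_triple r c j H X A S P \<longleftrightarrow>
    A ** S 0 - S 0 ** ctranspose A = \<i> *\<^sub>m (P 0 ** j ** ctranspose (P 0)) \<and>
    S 0 = ctranspose (S 0) \<and>
    has_ae_derivative_on P
      (\<lambda>x. - (\<i> *\<^sub>m (\<Sum>k=1..r. resolvent A (of_real (c k)) ** P x ** j ** H k x))) X \<and>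
    has_ae_derivative_on S
      (\<lambda>x. - (\<Sum>k=1..r. resolvent A (of_real (c k)) ** P x ** j ** H k x ** j **
                 ctranspose (P x) ** resolvent (ctranspose A) (of_real (c k)))) X"

definition w_transfer ::
    "complex^'m^'m \<Rightarrow> complex^'n^'n \<Rightarrow> (real \<Rightarrow> complex^'n^'n) \<Rightarrow> (real \<Rightarrow> complex^'m^'n) \<Rightarrow>
     real \<Rightarrow> complex \<Rightarrow> complex^'m^'m"
  where "w_transfer j A S P x z =
    mat 1 - \<i> *\<^sub>m (j ** ctranspose (P x) ** matrix_inv (S x) ** resolvent A z ** P x)"

definition gbdt_X ::
    "(nat \<Rightarrow> real) \<Rightarrow> complex^'m^'m \<Rightarrow> complex^'n^'n \<Rightarrow> (real \<Rightarrow> complex^'n^'n) \<Rightarrow>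
     (real \<Rightarrow> complex^'m^'n) \<Rightarrow> nat \<Rightarrow> real \<Rightarrow> complex^'m^'m"
  where "gbdt_X c j A S P k x =
    \<i> *\<^sub>m (j ** ctranspose (P x) ** matrix_inv (S x) ** resolvent A (of_real (c k)) ** P x)"

definition gbdt_Y ::
    "(nat \<Rightarrow> real) \<Rightarrow> complex^'m^'m \<Rightarrow> complex^'n^'n \<Rightarrow> (real \<Rightarrow> complex^'n^'n) \<Rightarrow>
     (real \<Rightarrow> complex^'m^'n) \<Rightarrow> nat \<Rightarrow> real \<Rightarrow> complex^'m^'m"
  where "gbdt_Y c j A S P k x =
    \<i> *\<^sub>m (j ** ctranspose (P x) ** resolvent (ctranspose A) (of_real (c k)) **
            matrix_inv (S x) ** P x)"

definition gbdt_H ::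
    "(nat \<Rightarrow> real) \<Rightarrow> complex^'m^'m \<Rightarrow> (nat \<Rightarrow> real \<Rightarrow> complex^'m^'m) \<Rightarrow> complex^'n^'n \<Rightarrow>
     (real \<Rightarrow> complex^'n^'n) \<Rightarrow> (real \<Rightarrow> complex^'m^'n) \<Rightarrow> nat \<Rightarrow> real \<Rightarrow> complex^'m^'m"
  where "gbdt_H c j H A S P k x =
    (let X = gbdt_X c j A S P k x; Y = gbdt_Y c j A S P k x
     in H k x + H k x ** Y - j ** X ** j ** H k x - j ** X ** j ** H k x ** Y)"

definition gbdt_coeff ::
    "nat \<Rightarrow> (nat \<Rightarrow> real) \<Rightarrow> complex^'m^'m \<Rightarrow> (nat \<Rightarrow> real \<Rightarrow> complex^'m^'m) \<Rightarrow> complex^'n^'n \<Rightarrow>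
     (real \<Rightarrow> complex^'n^'n) \<Rightarrow> (real \<Rightarrow> complex^'m^'n) \<Rightarrow> real \<Rightarrow> complex \<Rightarrow> complex^'m^'m"
  where "gbdt_coeff r c j H A S P = system_coeff r c j (gbdt_H c j H A S P)"

definition gbdt_beta ::
    "(nat \<Rightarrow> real) \<Rightarrow> complex^'m^'m \<Rightarrow> (nat \<Rightarrow> real \<Rightarrow> complex^'m^'p) \<Rightarrow> complex^'n^'n \<Rightarrow>
     (real \<Rightarrow> complex^'n^'n) \<Rightarrow> (real \<Rightarrow> complex^'m^'n) \<Rightarrow> nat \<Rightarrow> real \<Rightarrow> complex^'m^'p"
  where "gbdt_beta c j \<beta> A S P k x =
    \<beta> k x ** j ** ctranspose (w_transfer j A S P x (of_real (c k))) ** j"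

end

theory Submission
  imports Defs
begin

text \<open>
  Write \<open>V = j P\<^sup>*\<close>, \<open>M\<close> for the inverse of \<open>S\<close>, \<open>R\<^sub>z\<close> for the resolvent of \<open>A\<close> and \<open>L\<^sub>u\<close> for the resolvent of
  \<open>A\<^sup>*\<close>. The transfer function is \<open>w(z) = 1 - \<i> V M R\<^sub>z P\<close>. The equations for \<open>P\<close> and \<open>S\<close> are chosen so that the
  identity \<open>A S - S A\<^sup>* = \<i> P V\<close>, assumed at the point \<open>0\<close>, and the symmetry \<open>S = S\<^sup>*\<close> hold on the whole interval:
  in both cases the difference of the two sides has derivative zero (\<open>matrix_identity\<close>, \<open>S_adjoint\<close>).

  The algebraic claims follow from the product formula
  \<open>(1 + \<i> V L\<^sub>u M P) w(z) = 1 - \<i> (z - u) V L\<^sub>u M R\<^sub>z P\<close> (\<open>transfer_product\<close>), which is that identity between two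
  resolvents. For \<open>u = z\<close> it shows that \<open>w(z)\<close> is invertible when \<open>z\<close> avoids both spectra. For \<open>u = c\<^sub>k\<close> the
  first factor is \<open>1 + Y\<^sub>k\<close>, and the factor \<open>z - c\<^sub>k\<close> on the right removes the pole from
  \<open>(z - c\<^sub>k)\<^sup>-\<^sup>1 (1 + Y\<^sub>k) w(z)\<close>. Together with the resolvent identity this makes the \<open>k\<close>-th term of
  \<open>G\<^sub>t w - w G\<close>, where \<open>G\<^sub>t\<close> is the coefficient of the transformed system, equal to the \<open>k\<close>-th term of the
  derivative of \<open>w\<close> (\<open>darboux_term\<close>, \<open>transfer_derivative\<close>). The same matrices give the new Hamiltonians:
  \<open>1 + Y\<^sub>k = j w(c\<^sub>k)\<^sup>* j\<close>, and its adjoint is \<open>1 - j X\<^sub>k j\<close>.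

  Finally, if \<open>w\<close> is invertible and satisfies the Darboux equation, multiplication by \<open>w\<close> carries fundamental
  solutions to fundamental solutions, and two fundamental solutions of one system differ by a constant
  right factor, since their quotient has derivative zero.

  The coefficients are only summable, so derivatives exist almost everywhere. The analytic input is that an
  absolutely continuous function whose derivative vanishes almost everywhere is constant
  (\<open>abs_continuous_null_derivative\<close>), together with the product rule and the rule for the inverse of a matrix
  function in this setting.
\<close>

section \<open>Matrix calculus\<close>

lemma cmat_scale_nth [simp]: "(a *\<^sub>m M) $ i $ l = a * M $ i $ l"
  by (simp add: cmat_scale_def)

lemma matrix_mul_scale_left: "(a *\<^sub>m M) ** N = a *\<^sub>m (M ** N)"
  by (simp add: vec_eq_iff matrix_matrix_mult_def sum_distrib_left mult.assoc)

lemma matrix_mul_scale_right: "M ** (a *\<^sub>m N) = a *\<^sub>m (M ** N)"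
  by (simp add: vec_eq_iff matrix_matrix_mult_def sum_distrib_left algebra_simps)

lemma bounded_bilinear_matrix_mul:
  "bounded_bilinear ((**) :: complex^'b^'a \<Rightarrow> complex^'c^'b \<Rightarrow> complex^'c^'a)"
proof -
  have "bilinear ((**) :: complex^'b^'a \<Rightarrow> complex^'c^'b \<Rightarrow> complex^'c^'a)"
    unfolding bilinear_def
    by (intro conjI allI linearI)
      (simp_all add: vec_eq_iff matrix_matrix_mult_def algebra_simps sum.distrib scaleR_sum_right)
  then show ?thesis
    by (simp add: bilinear_conv_bounded_bilinear)
qed

lemmas matrix_mul_add_left = bounded_bilinear.add_left [OF bounded_bilinear_matrix_mul]
  and matrix_mul_add_right = bounded_bilinear.add_right [OF bounded_bilinear_matrix_mul]
  and matrix_mul_diff_left = bounded_bilinear.diff_left [OF bounded_bilinear_matrix_mul]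
  and matrix_mul_diff_right = bounded_bilinear.diff_right [OF bounded_bilinear_matrix_mul]
  and matrix_mul_minus_left = bounded_bilinear.minus_left [OF bounded_bilinear_matrix_mul]
  and matrix_mul_minus_right = bounded_bilinear.minus_right [OF bounded_bilinear_matrix_mul]
  and matrix_mul_sum_left = bounded_bilinear.sum_left [OF bounded_bilinear_matrix_mul]
  and matrix_mul_sum_right = bounded_bilinear.sum_right [OF bounded_bilinear_matrix_mul]

lemmas matrix_expand = matrix_mul_assoc matrix_mul_scale_left matrix_mul_scale_right
  matrix_mul_add_left matrix_mul_add_right matrix_mul_diff_left matrix_mul_diff_right
  matrix_mul_minus_left matrix_mul_minus_right matrix_mul_sum_left matrix_mul_sum_right

lemmas bounded_linear_matrix_mul_left = bounded_bilinear.bounded_linear_left [OF bounded_bilinear_matrix_mul]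
  and bounded_linear_matrix_mul_right = bounded_bilinear.bounded_linear_right [OF bounded_bilinear_matrix_mul]

lemma bounded_linear_cmat_scale: "bounded_linear (\<lambda>M :: complex^'b^'a. a *\<^sub>m M)"
  by (intro linear_conv_bounded_linear [THEN iffD1] linearI)
    (simp_all add: vec_eq_iff algebra_simps)

lemma bounded_linear_ctranspose: "bounded_linear (ctranspose :: complex^'b^'a \<Rightarrow> complex^'a^'b)"
  by (intro linear_conv_bounded_linear [THEN iffD1] linearI)
    (simp_all add: vec_eq_iff ctranspose_def)

lemma ctranspose_ctranspose [simp]: "ctranspose (ctranspose M) = M"
  by (simp add: vec_eq_iff ctranspose_def)

lemma ctranspose_mul: "ctranspose (M ** N) = ctranspose N ** ctranspose M"
  by (simp add: vec_eq_iff ctranspose_def matrix_matrix_mult_def mult.commute)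

lemma ctranspose_scale: "ctranspose (a *\<^sub>m M) = cnj a *\<^sub>m ctranspose M"
  by (simp add: vec_eq_iff ctranspose_def)

lemma ctranspose_mat [simp]: "ctranspose (mat a) = mat (cnj a)"
  by (simp add: vec_eq_iff ctranspose_def mat_def)

lemmas ctranspose_linear =
  linear_add [OF bounded_linear.linear [OF bounded_linear_ctranspose]]
  linear_diff [OF bounded_linear.linear [OF bounded_linear_ctranspose]]
  linear_neg [OF bounded_linear.linear [OF bounded_linear_ctranspose]]
  linear_sum [OF bounded_linear.linear [OF bounded_linear_ctranspose]]

lemma matrix_inv_invertible:
  fixes M :: "complex^'n^'n"
  assumes "invertible M"
  shows "M ** matrix_inv M = mat 1" "matrix_inv M ** M = mat 1"
proof -
  have "\<exists>N. M ** N = mat 1 \<and> N ** M = mat 1"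
    using assms by (simp add: invertible_def)
  then have "M ** matrix_inv M = mat 1 \<and> matrix_inv M ** M = mat 1"
    unfolding matrix_inv_def by (rule someI_ex)
  then show "M ** matrix_inv M = mat 1" "matrix_inv M ** M = mat 1"
    by simp_all
qed

lemma matrix_inv_eqI:
  fixes M N :: "complex^'n^'n"
  assumes "M ** N = mat 1"
  shows "matrix_inv M = N" "invertible M"
proof -
  show inv: "invertible M"
    using assms invertible_right_inverse by blast
  have "matrix_inv M = matrix_inv M ** (M ** N)"
    by (simp add: assms)
  also have "\<dots> = N"
    by (simp add: matrix_mul_assoc matrix_inv_invertible [OF inv])
  finally show "matrix_inv M = N" .
qed

lemma ctranspose_matrix_inv:
  fixes M :: "complex^'n^'n"
  assumes "invertible M"
  shows "matrix_inv (ctranspose M) = ctranspose (matrix_inv M)" "invertible (ctranspose M)"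
proof -
  have "ctranspose M ** ctranspose (matrix_inv M) = mat 1"
    by (simp add: ctranspose_mul [symmetric] matrix_inv_invertible [OF assms])
  then show "matrix_inv (ctranspose M) = ctranspose (matrix_inv M)" "invertible (ctranspose M)"
    by (rule matrix_inv_eqI)+
qed

lemma signature_mat_square:
  "signature_mat k ** signature_mat k = (mat 1 :: complex^'m::{finite,linorder}^'m::{finite,linorder})"
proof -
  define s :: "'m \<Rightarrow> complex" where "s a = (if card {d. d < a} < k then 1 else - 1)" for a
  have "(\<Sum>b\<in>UNIV. (if a = b then s a else 0) * (if b = c then s b else 0))
      = (\<Sum>b\<in>UNIV. if a = b then (if b = c then 1 else 0) else 0)" for a c
    by (intro sum.cong) (auto simp: s_def)
  moreover have "signature_mat k = (\<chi> a b. if a = b then s a else 0)"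
    by (simp only: signature_mat_def s_def)
  ultimately show ?thesis
    by (simp add: vec_eq_iff mat_def matrix_matrix_mult_def)
qed

lemma ctranspose_signature_mat:
  "ctranspose (signature_mat k) = (signature_mat k :: complex^'m::{finite,linorder}^'m::{finite,linorder})"
  by (simp add: vec_eq_iff signature_mat_def ctranspose_def)

section \<open>Absolutely continuous functions\<close>

text \<open>The definition speaks of families indexed by an initial segment of the
  naturals. Tagged divisions are sets of pairs, so families over any finite index set are needed.\<close>

lemma abs_continuous_finite_families:
  assumes f: "abs_continuous a b f" and e: "0 < (e::real)"
  obtains d where "0 < d" and
    "\<And>(D::'i set) u v. \<lbrakk>finite D; \<And>i. i \<in> D \<Longrightarrow> a \<le> u i \<and> u i \<le> v i \<and> v i \<le> b;
        disjoint_family_on (\<lambda>i. {u i<..<v i}) D; (\<Sum>i\<in>D. v i - u i) < d\<rbrakk>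
      \<Longrightarrow> (\<Sum>i\<in>D. norm (f (v i) - f (u i))) < e"
proof -
  from f [unfolded abs_continuous_def, rule_format, OF e]
  obtain d where d: "0 < d" and
    D: "\<And>(N::nat) u v. \<lbrakk>\<forall>i<N. a \<le> u i \<and> u i \<le> v i \<and> v i \<le> b;
      \<forall>i<N. \<forall>l<N. i \<noteq> l \<longrightarrow> {u i<..<v i} \<inter> {u l<..<v l} = {}; (\<Sum>i<N. v i - u i) < d\<rbrakk>
      \<Longrightarrow> (\<Sum>i<N. norm (f (v i) - f (u i))) < e"
    by blast
  show thesis
  proof (rule that [OF d])
    fix D :: "'i set" and u v :: "'i \<Rightarrow> real"
    assume fin: "finite D" and le: "\<And>i. i \<in> D \<Longrightarrow> a \<le> u i \<and> u i \<le> v i \<and> v i \<le> b"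
      and dis: "disjoint_family_on (\<lambda>i. {u i<..<v i}) D" and sum: "(\<Sum>i\<in>D. v i - u i) < d"
    obtain h where h: "bij_betw h {..<card D} D"
      using ex_bij_betw_nat_finite [OF fin] by (auto simp: lessThan_atLeast0)
    have mem: "h i \<in> D" if "i < card D" for i
      using h that by (auto simp: bij_betw_def)
    have inj: "h i \<noteq> h l" if "i < card D" "l < card D" "i \<noteq> l" for i l
      using h that by (auto simp: bij_betw_def inj_on_def)
    have "(\<Sum>i<card D. norm (f (v (h i)) - f (u (h i)))) < e"
    proof (rule D)
      show "\<forall>i<card D. a \<le> u (h i) \<and> u (h i) \<le> v (h i) \<and> v (h i) \<le> b"
        using le mem by blast
      show "\<forall>i<card D. \<forall>l<card D. i \<noteq> l \<longrightarrow> {u (h i)<..<v (h i)} \<inter> {u (h l)<..<v (h l)} = {}"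
        using dis mem inj unfolding disjoint_family_on_def by blast
      show "(\<Sum>i<card D. v (h i) - u (h i)) < d"
        using sum sum.reindex_bij_betw [OF h, of "\<lambda>i. v i - u i"] by simp
    qed
    then show "(\<Sum>i\<in>D. norm (f (v i) - f (u i))) < e"
      using sum.reindex_bij_betw [OF h, of "\<lambda>i. norm (f (v i) - f (u i))"] by simp
  qed
qed

lemma abs_continuous_imp_continuous_on:
  assumes "abs_continuous a b f"
  shows "continuous_on {a..b} f"
proof (rule continuous_onI)
  fix x e :: real
  assume x: "x \<in> {a..b}" and e: "0 < e"
  obtain d where d: "0 < d" and
    D: "\<And>(D::unit set) u v. \<lbrakk>finite D; \<And>i. i \<in> D \<Longrightarrow> a \<le> u i \<and> u i \<le> v i \<and> v i \<le> b;
        disjoint_family_on (\<lambda>i. {u i<..<v i}) D; (\<Sum>i\<in>D. v i - u i) < d\<rbrakk>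
      \<Longrightarrow> (\<Sum>i\<in>D. norm (f (v i) - f (u i))) < e"
    by (fact abs_continuous_finite_families [OF assms e])
  have "dist (f y) (f x) \<le> e" if y: "y \<in> {a..b}" "dist y x < d" for y
    using D [of "{()}" "\<lambda>_. x" "\<lambda>_. y"] D [of "{()}" "\<lambda>_. y" "\<lambda>_. x"] x y
    by (cases "x \<le> y") (auto simp: disjoint_family_on_def dist_real_def dist_norm norm_minus_commute)
  with d show "\<exists>d>0. \<forall>y\<in>{a..b}. dist y x < d \<longrightarrow> dist (f y) (f x) \<le> e"
    by blast
qed

text \<open>Every closure property below comes from this comparison: sums, products, images under linear
  maps and matrix inverses are all functions whose increments are dominated by those of the data.\<close>

lemma abs_continuous_dominated:
  assumes f: "abs_continuous a b f" and g: "abs_continuous a b g"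
    and le: "\<And>u v. \<lbrakk>u \<in> {a..b}; v \<in> {a..b}\<rbrakk> \<Longrightarrow>
      norm (h v - h u) \<le> C * (norm (f v - f u) + norm (g v - g u))"
  shows "abs_continuous a b h"
  unfolding abs_continuous_def
proof (intro allI impI)
  fix e :: real
  assume e: "0 < e"
  define K where "K = \<bar>C\<bar> + 1"
  have K: "0 < K" "C \<le> K"
    by (auto simp: K_def)
  then have e': "0 < e / (2 * K)"
    using e by simp
  obtain d1 where d1: "0 < d1" and
    D1: "\<And>(D::nat set) u v. \<lbrakk>finite D; \<And>i. i \<in> D \<Longrightarrow> a \<le> u i \<and> u i \<le> v i \<and> v i \<le> b;
        disjoint_family_on (\<lambda>i. {u i<..<v i}) D; (\<Sum>i\<in>D. v i - u i) < d1\<rbrakk>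
      \<Longrightarrow> (\<Sum>i\<in>D. norm (f (v i) - f (u i))) < e / (2 * K)"
    by (fact abs_continuous_finite_families [OF f e'])
  obtain d2 where d2: "0 < d2" and
    D2: "\<And>(D::nat set) u v. \<lbrakk>finite D; \<And>i. i \<in> D \<Longrightarrow> a \<le> u i \<and> u i \<le> v i \<and> v i \<le> b;
        disjoint_family_on (\<lambda>i. {u i<..<v i}) D; (\<Sum>i\<in>D. v i - u i) < d2\<rbrakk>
      \<Longrightarrow> (\<Sum>i\<in>D. norm (g (v i) - g (u i))) < e / (2 * K)"
    by (fact abs_continuous_finite_families [OF g e'])
  show "\<exists>d>0. \<forall>(N::nat) u v. (\<forall>i<N. a \<le> u i \<and> u i \<le> v i \<and> v i \<le> b) \<and>
      (\<forall>i<N. \<forall>l<N. i \<noteq> l \<longrightarrow> {u i<..<v i} \<inter> {u l<..<v l} = {}) \<and> (\<Sum>i<N. v i - u i) < d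
      \<longrightarrow> (\<Sum>i<N. norm (h (v i) - h (u i))) < e"
  proof (intro exI [of _ "min d1 d2"] conjI allI impI)
    fix N :: nat and u v :: "nat \<Rightarrow> real"
    assume *: "(\<forall>i<N. a \<le> u i \<and> u i \<le> v i \<and> v i \<le> b) \<and>
      (\<forall>i<N. \<forall>l<N. i \<noteq> l \<longrightarrow> {u i<..<v i} \<inter> {u l<..<v l} = {}) \<and> (\<Sum>i<N. v i - u i) < min d1 d2"
    have "(\<Sum>i<N. norm (h (v i) - h (u i)))
        \<le> (\<Sum>i<N. K * (norm (f (v i) - f (u i)) + norm (g (v i) - g (u i))))"
    proof (rule sum_mono)
      fix i assume "i \<in> {..<N}"
      then have "a \<le> u i \<and> u i \<le> v i \<and> v i \<le> b"
        using * by blast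
      then have "u i \<in> {a..b}" "v i \<in> {a..b}"
        by auto
      then have "norm (h (v i) - h (u i)) \<le> C * (norm (f (v i) - f (u i)) + norm (g (v i) - g (u i)))"
        by (rule le)
      also have "\<dots> \<le> K * (norm (f (v i) - f (u i)) + norm (g (v i) - g (u i)))"
        using K by (intro mult_right_mono) auto
      finally show "norm (h (v i) - h (u i))
          \<le> K * (norm (f (v i) - f (u i)) + norm (g (v i) - g (u i)))" .
    qed
    also have "\<dots> = K * ((\<Sum>i<N. norm (f (v i) - f (u i))) + (\<Sum>i<N. norm (g (v i) - g (u i))))"
      by (simp add: sum_distrib_left [symmetric] sum.distrib [symmetric])
    also have "\<dots> < K * (e / (2 * K) + e / (2 * K))"
    proof (intro mult_strict_left_mono add_strict_mono)
      have dis: "disjoint_family_on (\<lambda>i. {u i<..<v i}) {..<N}"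
        using * unfolding disjoint_family_on_def by blast
      have le: "\<And>i. i \<in> {..<N} \<Longrightarrow> a \<le> u i \<and> u i \<le> v i \<and> v i \<le> b"
        using * by blast
      have sum: "(\<Sum>i<N. v i - u i) < d1" "(\<Sum>i<N. v i - u i) < d2"
        using * by linarith+
      show "(\<Sum>i<N. norm (f (v i) - f (u i))) < e / (2 * K)"
        by (rule D1 [OF finite_lessThan le dis sum(1)])
      show "(\<Sum>i<N. norm (g (v i) - g (u i))) < e / (2 * K)"
        by (rule D2 [OF finite_lessThan le dis sum(2)])
    qed (rule K)
    also have "\<dots> = e"
      using K by simp
    finally show "(\<Sum>i<N. norm (h (v i) - h (u i))) < e" .
  qed (use d1 d2 in auto)
qed

text \<open>Cousin's lemma. At a point with vanishing derivative the
  gauge makes the increment over a small interval at most \<open>e\<close> times its length. The exceptional null set is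
  covered by an open set of measure below \<open>\<delta>\<close>, and the gauge keeps intervals tagged there inside it, so
  that absolute continuity bounds the sum of their increments by \<open>e\<close>. Summing over a fine tagged division
  of \<open>{a..b}\<close> bounds the total increment by \<open>e * (b - a) + e\<close>.\<close>

lemma abs_continuous_null_derivative:
  fixes f :: "real \<Rightarrow> 'a::real_normed_vector"
  assumes f: "abs_continuous a b f" and ab: "a \<le> b"
    and der: "AE x\<in>{a..b} in lebesgue. (f has_vector_derivative 0) (at x within {a..b})"
  shows "f b = f a"
proof -
  have bound: "norm (f b - f a) \<le> e * (b - a) + e" if e: "0 < e" for e
  proof -
    obtain \<delta> where \<delta>: "0 < \<delta>" and
      D: "\<And>(D::(real \<times> real set) set) u v.
        \<lbrakk>finite D; \<And>i. i \<in> D \<Longrightarrow> a \<le> u i \<and> u i \<le> v i \<and> v i \<le> b;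
          disjoint_family_on (\<lambda>i. {u i<..<v i}) D; (\<Sum>i\<in>D. v i - u i) < \<delta>\<rbrakk>
        \<Longrightarrow> (\<Sum>i\<in>D. norm (f (v i) - f (u i))) < e"
      by (fact abs_continuous_finite_families [OF f e])
    obtain N where N: "N \<in> null_sets lebesgue" and
      N_der: "\<And>x. x \<in> space lebesgue - N \<Longrightarrow>
        x \<in> {a..b} \<longrightarrow> (f has_vector_derivative 0) (at x within {a..b})"
      using AE_E3 [OF der] by blast
    have dN: "(f has_vector_derivative 0) (at x within {a..b})" if "x \<in> {a..b}" "x \<notin> N" for x
      using N_der [of x] that by simp
    obtain U where U: "open U" "N \<subseteq> U" "emeasure lebesgue (U - N) < ennreal \<delta>"
      using sets_lebesgue_outer_open [of N \<delta>] N \<delta> by (metis null_setsD2)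
    have U_small: "emeasure lebesgue U < ennreal \<delta>"
      using U N by (simp add: emeasure_Diff_null_set borel_open)
    have U_meas: "U \<in> lmeasurable"
      using U_small U(1) by (intro fmeasurableI) (auto simp: borel_open intro: order.strict_trans)
    have "\<exists>d>0. x \<in> {a..b} - N \<longrightarrow>
        (\<forall>y\<in>{a..b}. \<bar>y - x\<bar> < d \<longrightarrow> norm (f y - f x) \<le> e * \<bar>y - x\<bar>)" for x
    proof (cases "x \<in> {a..b} - N")
      case True
      then have "(f has_derivative (\<lambda>h. 0)) (at x within {a..b})"
        using dN [of x] by (simp add: has_vector_derivative_def)
      then show ?thesis
        unfolding has_derivative_within_alt using e by fastforce
    qed (auto intro: exI [of _ 1])
    then obtain d where d_dd: "\<And>x. 0 < d x \<and> (x \<in> {a..b} - N \<longrightarrow>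
        (\<forall>y\<in>{a..b}. \<bar>y - x\<bar> < d x \<longrightarrow> norm (f y - f x) \<le> e * \<bar>y - x\<bar>))"
      by metis
    then have d: "0 < d x" for x
      by blast
    have dd: "norm (f y - f x) \<le> e * \<bar>y - x\<bar>"
      if "x \<in> {a..b} - N" "y \<in> {a..b}" "\<bar>y - x\<bar> < d x" for x y
      using d_dd that by blast
    define \<gamma> where "\<gamma> x = (if x \<in> N then U else ball x (d x))" for x
    have "gauge \<gamma>"
      using U d by (auto simp: gauge_def \<gamma>_def)
    then obtain p where p: "p tagged_division_of {a..b}" "\<gamma> fine p"
      by (rule fine_division_exists_real)
    note tag = tagged_division_ofD [OF p(1)]
    have K: "\<exists>u v. K = {u..v} \<and> u \<le> v \<and> a \<le> u \<and> v \<le> b \<and> u \<le> x \<and> x \<le> v"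
      if xK: "(x, K) \<in> p" for x K
    proof -
      obtain u v where "K = {u..v}"
        using tag(4) [OF xK] by auto
      then show ?thesis
        using tag(2,3) [OF xK] by (intro exI [of _ u] exI [of _ v]) auto
    qed
    define u v :: "real \<times> real set \<Rightarrow> real"
      where "u i = Inf (snd i)" and "v i = Sup (snd i)" for i
    have uv: "snd i = {u i..v i}" "u i \<le> v i" "a \<le> u i" "v i \<le> b" "u i \<le> fst i" "fst i \<le> v i"
      if ip: "i \<in> p" for i
    proof -
      obtain s t where st: "snd i = {s..t}" "s \<le> t" "a \<le> s" "t \<le> b" "s \<le> fst i" "fst i \<le> t"
        using K [of "fst i" "snd i"] ip by auto
      then have "u i = s" "v i = t"
        by (simp_all add: u_def v_def)
      with st show "snd i = {u i..v i}" "u i \<le> v i" "a \<le> u i" "v i \<le> b" "u i \<le> fst i" "fst i \<le> v i"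
        by simp_all
    qed
    have disj: "disjoint_family_on (\<lambda>i. {u i<..<v i}) p"
    proof (unfold disjoint_family_on_def, intro ballI impI)
      fix i l assume il: "i \<in> p" "l \<in> p" "i \<noteq> l"
      then have "interior (snd i) \<inter> interior (snd l) = {}"
        by (intro tag(5) [of "fst i" _ "fst l"]) (auto simp: prod_eq_iff)
      then show "{u i<..<v i} \<inter> {u l<..<v l} = {}"
        by (simp only: uv(1) [OF il(1)] uv(1) [OF il(2)] interior_atLeastAtMost_real)
    qed
    have fine: "snd i \<subseteq> \<gamma> (fst i)" if "i \<in> p" for i
      using fineD [OF p(2), of "fst i" "snd i"] that by simp
    define q where "q = {i \<in> p. fst i \<in> N}"
    have q: "q \<subseteq> p" "finite q"
      using tag(1) by (auto simp: q_def)
    have total: "(\<Sum>i\<in>p. g (v i) - g (u i)) = g b - g a" for g :: "real \<Rightarrow> 'c::real_normed_vector"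
      using additive_tagged_division_1 [OF ab p(1), of g] by (simp add: u_def v_def case_prod_beta)
    have disjq: "disjoint_family_on (\<lambda>i. {u i<..<v i}) q"
      using q(1) disj by (rule disjoint_family_on_mono)
    \<comment> \<open>The intervals tagged in the null set lie in a set of measure below \<open>\<delta>\<close>.\<close>
    have q_small: "(\<Sum>i\<in>q. v i - u i) < \<delta>"
    proof -
      have "(\<Sum>i\<in>q. v i - u i) = (\<Sum>i\<in>q. measure lebesgue {u i<..<v i})"
        using uv(2) q(1) by (intro sum.cong) auto
      also have "\<dots> = measure lebesgue (\<Union>i\<in>q. {u i<..<v i})"
      proof (rule measure_finite_Union [symmetric, OF q(2) _ disjq])
        show "emeasure lebesgue {u i<..<v i} \<noteq> \<infinity>" if "i \<in> q" for i
          using uv(2) [OF subsetD [OF q(1) that]] by (simp add: emeasure_lborel_Ioo)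
      qed auto
      also have "\<dots> \<le> measure lebesgue U"
      proof (rule measure_mono_fmeasurable)
        show "(\<Union>i\<in>q. {u i<..<v i}) \<subseteq> U"
        proof (rule UN_least)
          fix i assume i: "i \<in> q"
          then have "snd i \<subseteq> U"
            using fine [of i] by (simp add: q_def \<gamma>_def)
          then show "{u i<..<v i} \<subseteq> U"
            using uv(1) [OF subsetD [OF q(1) i]] by auto
        qed
        show "U \<in> lmeasurable"
          by (rule U_meas)
        show "(\<Union>i\<in>q. {u i<..<v i}) \<in> sets lebesgue"
          using q(2) by (intro sets.finite_UN) auto
      qed
      also have "\<dots> < \<delta>"
        using U_small \<delta> by (simp add: emeasure_eq_measure2 [OF U_meas] ennreal_less_iff)
      finally show ?thesis .
    qed
    have bad: "(\<Sum>i\<in>q. norm (f (v i) - f (u i))) < e"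
    proof (rule D [OF q(2) _ disjq q_small])
      show "a \<le> u i \<and> u i \<le> v i \<and> v i \<le> b" if "i \<in> q" for i
        using uv(2-4) [OF subsetD [OF q(1) that]] by blast
    qed
    have good: "norm (f (v i) - f (u i)) \<le> e * (v i - u i)" if i: "i \<in> p - q" for i
    proof -
      have ip: "i \<in> p"
        using i by simp
      note le = uv(2-6) [OF ip]
      have x: "fst i \<in> {a..b} - N"
        using i le by (auto simp: q_def)
      then have "{u i..v i} \<subseteq> ball (fst i) (d (fst i))"
        using fine [OF ip] uv(1) [OF ip] by (simp add: \<gamma>_def)
      then have "u i \<in> ball (fst i) (d (fst i))" "v i \<in> ball (fst i) (d (fst i))"
        using le(1) by (simp_all add: subset_iff)
      then have mem: "\<bar>u i - fst i\<bar> < d (fst i)" "\<bar>v i - fst i\<bar> < d (fst i)"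
        by (auto simp: dist_real_def)
      have "norm (f (u i) - f (fst i)) \<le> e * \<bar>u i - fst i\<bar>"
        using le mem by (intro dd [OF x]) auto
      moreover have "norm (f (v i) - f (fst i)) \<le> e * \<bar>v i - fst i\<bar>"
        using le mem by (intro dd [OF x]) auto
      moreover have "norm (f (v i) - f (u i)) \<le> norm (f (v i) - f (fst i)) + norm (f (u i) - f (fst i))"
        using norm_triangle_ineq4 [of "f (v i) - f (fst i)" "f (u i) - f (fst i)"] by simp
      moreover have "e * \<bar>u i - fst i\<bar> + e * \<bar>v i - fst i\<bar> = e * (v i - u i)"
        using le by (simp add: algebra_simps)
      ultimately show ?thesis
        by linarith
    qed
    have "norm (f b - f a) \<le> (\<Sum>i\<in>p. norm (f (v i) - f (u i)))"
      using total [of f] norm_sum [of "\<lambda>i. f (v i) - f (u i)" p] by simp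
    also have "\<dots> = (\<Sum>i\<in>p - q. norm (f (v i) - f (u i))) + (\<Sum>i\<in>q. norm (f (v i) - f (u i)))"
      using tag(1) q(1) by (rule sum.subset_diff [rotated])
    also have "\<dots> \<le> (\<Sum>i\<in>p - q. e * (v i - u i)) + e"
      using bad good by (intro add_mono sum_mono) auto
    also have "(\<Sum>i\<in>p - q. e * (v i - u i)) \<le> (\<Sum>i\<in>p. e * (v i - u i))"
      using tag(1) e uv(2) by (intro sum_mono2) auto
    also have "\<dots> = e * (b - a)"
      using total [of "\<lambda>x. x"] by (simp add: sum_distrib_left [symmetric])
    finally show ?thesis by simp
  qed
  have "norm (f b - f a) \<le> 0"
  proof (rule field_le_epsilon)
    fix e :: real
    assume e: "0 < e"
    define e' where "e' = e / (b - a + 1)"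
    have "0 < e'" "e' * (b - a + 1) = e"
      using e ab by (simp_all add: e'_def)
    then show "norm (f b - f a) \<le> 0 + e"
      using bound [of e'] by (simp add: algebra_simps)
  qed
  then show ?thesis by simp
qed

lemma continuous_on_Icc_bounded:
  fixes f :: "real \<Rightarrow> 'a::real_normed_vector"
  assumes "continuous_on {a..b} f"
  obtains B where "0 < B" "\<And>x. x \<in> {a..b} \<Longrightarrow> norm (f x) \<le> B"
proof -
  have "bounded (f ` {a..b})"
    using assms by (intro compact_imp_bounded compact_continuous_image) auto
  then obtain B where "0 < B" "\<forall>y\<in>f ` {a..b}. norm y \<le> B"
    unfolding bounded_pos by blast
  then show thesis
    by (intro that [of B]) blast+
qed

lemma abs_continuous_bilinear:
  assumes mul: "bounded_bilinear mul" and f: "abs_continuous a b f" and g: "abs_continuous a b g"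
  shows "abs_continuous a b (\<lambda>x. mul (f x) (g x))"
proof -
  interpret bounded_bilinear mul by (rule mul)
  obtain K where K: "0 < K" "\<And>x y. norm (mul x y) \<le> norm x * norm y * K"
    using pos_bounded by blast
  obtain B where B: "0 < B" "\<And>x. x \<in> {a..b} \<Longrightarrow> norm (f x) \<le> B"
    by (fact continuous_on_Icc_bounded [OF abs_continuous_imp_continuous_on [OF f]])
  obtain C where C: "0 < C" "\<And>x. x \<in> {a..b} \<Longrightarrow> norm (g x) \<le> C"
    by (fact continuous_on_Icc_bounded [OF abs_continuous_imp_continuous_on [OF g]])
  define D where "D = max B C"
  have D: "0 \<le> D" "norm (f x) \<le> D" "norm (g x) \<le> D" if "x \<in> {a..b}" for x
    using B(1) B(2) [OF that] C(2) [OF that] by (simp_all add: D_def)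
  show ?thesis
  proof (rule abs_continuous_dominated [OF f g, where C = "K * D"])
    fix u v assume uv: "u \<in> {a..b}" "v \<in> {a..b}"
    have "norm (mul (f v) (g v) - mul (f u) (g u))
        \<le> norm (mul (f v - f u) (g v)) + norm (mul (f u) (g v - g u))"
      using norm_triangle_ineq [of "mul (f v - f u) (g v)" "mul (f u) (g v - g u)"]
      by (simp add: diff_left diff_right)
    also have "\<dots> \<le> norm (f v - f u) * norm (g v) * K + norm (f u) * norm (g v - g u) * K"
      by (intro add_mono K)
    also have "\<dots> \<le> norm (f v - f u) * D * K + D * norm (g v - g u) * K"
      using K(1) D uv by (intro add_mono mult_right_mono mult_left_mono) auto
    finally show "norm (mul (f v) (g v) - mul (f u) (g u))
        \<le> K * D * (norm (f v - f u) + norm (g v - g u))"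
      by (simp add: algebra_simps)
  qed
qed

lemma abs_continuous_linear:
  assumes T: "bounded_linear T" and f: "abs_continuous a b f"
  shows "abs_continuous a b (\<lambda>x. T (f x))"
proof -
  interpret bounded_linear T by (rule T)
  obtain K where K: "0 < K" "\<And>x. norm (T x) \<le> norm x * K"
    using pos_bounded by blast
  show ?thesis
  proof (rule abs_continuous_dominated [OF f f, where C = K])
    fix u v
    have "norm (T (f v) - T (f u)) \<le> norm (f v - f u) * K"
      using K(2) [of "f v - f u"] by (simp add: diff)
    also have "\<dots> \<le> (norm (f v - f u) + norm (f v - f u)) * K"
      using K(1) by (intro mult_right_mono) auto
    finally show "norm (T (f v) - T (f u)) \<le> K * (norm (f v - f u) + norm (f v - f u))"
      by (simp add: mult.commute)
  qed
qed

lemma abs_continuous_add: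
  assumes f: "abs_continuous a b f" and g: "abs_continuous a b g"
  shows "abs_continuous a b (\<lambda>x. f x + g x)"
proof (rule abs_continuous_dominated [OF f g, where C = 1])
  fix u v
  show "norm (f v + g v - (f u + g u)) \<le> 1 * (norm (f v - f u) + norm (g v - g u))"
    using norm_triangle_ineq [of "f v - f u" "g v - g u"] by (simp add: algebra_simps)
qed

section \<open>The inverse of a matrix function\<close>

lemma matrix_inv_diff:
  fixes M N :: "complex^'n^'n"
  assumes "invertible M" "invertible N"
  shows "matrix_inv N - matrix_inv M = - (matrix_inv N ** (N - M) ** matrix_inv M)"
proof -
  have "matrix_inv N ** (N - M) ** matrix_inv M
      = (matrix_inv N ** N) ** matrix_inv M - matrix_inv N ** (M ** matrix_inv M)"
    by (simp only: matrix_expand)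
  then show ?thesis
    by (simp add: matrix_inv_invertible assms)
qed

lemma matrix_inv_diff_bound:
  obtains K where "0 < K" and
    "\<And>M N :: complex^'n^'n. \<lbrakk>invertible M; invertible N\<rbrakk> \<Longrightarrow>
      norm (matrix_inv N - matrix_inv M) \<le> K * norm (matrix_inv N) * norm (matrix_inv M) * norm (N - M)"
proof -
  obtain K where K_mul: "0 < K \<and> (\<forall>(M :: complex^'n^'n) (N :: complex^'n^'n). norm (M ** N) \<le> norm M * norm N * K)"
    using bounded_bilinear.pos_bounded [OF bounded_bilinear_matrix_mul] by (rule exE)
  then have K: "0 < K" "norm (M ** N) \<le> norm M * norm N * K" for M N :: "complex^'n^'n"
    by simp_all
  have "norm (matrix_inv N - matrix_inv M)
      \<le> (K * K) * norm (matrix_inv N) * norm (matrix_inv M) * norm (N - M)"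
    if "invertible M" "invertible N" for M N :: "complex^'n^'n"
  proof -
    have "norm (matrix_inv N - matrix_inv M) \<le> norm (matrix_inv N ** (N - M)) * norm (matrix_inv M) * K"
      using K(2) by (simp add: matrix_inv_diff that)
    also have "\<dots> \<le> (norm (matrix_inv N) * norm (N - M) * K) * norm (matrix_inv M) * K"
      using K by (intro mult_right_mono K(2)) auto
    finally show ?thesis
      by (simp add: algebra_simps)
  qed
  then show thesis
    using K(1) by (intro that [of "K * K"]) auto
qed

text \<open>The bound above still contains the norm of the inverse at the moving point \<open>y\<close>. Near \<open>x\<close> it makes
  the difference of the inverses at most half that norm, which is therefore at most twice the norm of the
  inverse at \<open>x\<close>. Inserted into the bound, this gives convergence.\<close>

lemma tendsto_matrix_inv:
  fixes S :: "'a::topological_space \<Rightarrow> complex^'n^'n"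
  assumes S: "(S \<longlongrightarrow> S x) (at x within X)" and inv: "\<And>y. y \<in> X \<Longrightarrow> invertible (S y)"
    and x: "x \<in> X"
  shows "((\<lambda>y. matrix_inv (S y)) \<longlongrightarrow> matrix_inv (S x)) (at x within X)"
proof -
  obtain K where K: "0 < K" and
    bound: "\<And>M N :: complex^'n^'n. \<lbrakk>invertible M; invertible N\<rbrakk> \<Longrightarrow>
      norm (matrix_inv N - matrix_inv M) \<le> K * norm (matrix_inv N) * norm (matrix_inv M) * norm (N - M)"
    by (rule matrix_inv_diff_bound) blast
  define s where "s = norm (matrix_inv (S x))"
  have lim: "((\<lambda>y. norm (S y - S x)) \<longlongrightarrow> 0) (at x within X)"
    by (intro tendsto_norm_zero LIM_zero S)
  have "((\<lambda>y. K * s * norm (S y - S x)) \<longlongrightarrow> K * s * 0) (at x within X)"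
    by (intro tendsto_mult lim tendsto_const)
  then have "\<forall>\<^sub>F y in at x within X. K * s * norm (S y - S x) < 1 / 2"
    by (rule order_tendstoD) simp
  moreover have "\<forall>\<^sub>F y in at x within X. y \<in> X"
    by (simp add: eventually_at_filter)
  ultimately have "\<forall>\<^sub>F y in at x within X. norm (matrix_inv (S y) - matrix_inv (S x))
      \<le> K * (2 * s) * s * norm (S y - S x)"
  proof eventually_elim
    case (elim y)
    define t where "t = norm (matrix_inv (S y))"
    have 1: "norm (matrix_inv (S y) - matrix_inv (S x)) \<le> K * t * s * norm (S y - S x)"
      using bound [OF inv [OF x] inv [OF elim(2)]] by (simp add: s_def t_def)
    have "t * (K * s * norm (S y - S x)) \<le> t * (1 / 2)"
      using elim by (intro mult_left_mono) (auto simp: t_def)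
    moreover have "t - s \<le> norm (matrix_inv (S y) - matrix_inv (S x))"
      by (simp add: s_def t_def norm_triangle_ineq2)
    ultimately have "t \<le> 2 * s"
      using 1 by (simp add: algebra_simps)
    then have "K * t * s * norm (S y - S x) \<le> K * (2 * s) * s * norm (S y - S x)"
      using K by (intro mult_right_mono mult_left_mono) (auto simp: s_def)
    with 1 show ?case by linarith
  qed
  moreover have "((\<lambda>y. K * (2 * s) * s * norm (S y - S x)) \<longlongrightarrow> 0) (at x within X)"
    using tendsto_mult [OF tendsto_const [of "K * (2 * s) * s"] lim] by simp
  ultimately have "((\<lambda>y. matrix_inv (S y) - matrix_inv (S x)) \<longlongrightarrow> 0) (at x within X)"
    by (rule Lim_null_comparison)
  then show ?thesis
    by (rule LIM_zero_cancel)
qed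

lemma continuous_on_matrix_inv:
  fixes S :: "'a::topological_space \<Rightarrow> complex^'n^'n"
  assumes "continuous_on X S" and "\<And>x. x \<in> X \<Longrightarrow> invertible (S x)"
  shows "continuous_on X (\<lambda>x. matrix_inv (S x))"
  unfolding continuous_on_def
  using assms by (intro ballI tendsto_matrix_inv [where S = S]) (simp_all add: continuous_on_def)

lemma abs_continuous_matrix_inv:
  fixes S :: "real \<Rightarrow> complex^'n^'n"
  assumes S: "abs_continuous a b S" and inv: "\<And>x. x \<in> {a..b} \<Longrightarrow> invertible (S x)"
  shows "abs_continuous a b (\<lambda>x. matrix_inv (S x))"
proof -
  obtain K where K: "0 < K" and
    bound: "\<And>M N :: complex^'n^'n. \<lbrakk>invertible M; invertible N\<rbrakk> \<Longrightarrow>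
      norm (matrix_inv N - matrix_inv M) \<le> K * norm (matrix_inv N) * norm (matrix_inv M) * norm (N - M)"
    by (rule matrix_inv_diff_bound) blast
  have "continuous_on {a..b} (\<lambda>x. matrix_inv (S x))"
    by (intro continuous_on_matrix_inv abs_continuous_imp_continuous_on S inv)
  then obtain B where B: "0 < B" "\<And>x. x \<in> {a..b} \<Longrightarrow> norm (matrix_inv (S x)) \<le> B"
    by (rule continuous_on_Icc_bounded) blast
  show ?thesis
  proof (rule abs_continuous_dominated [OF S S, where C = "K * B * B"])
    fix u v assume uv: "u \<in> {a..b}" "v \<in> {a..b}"
    have "norm (matrix_inv (S v) - matrix_inv (S u))
        \<le> K * norm (matrix_inv (S v)) * norm (matrix_inv (S u)) * norm (S v - S u)"
      by (intro bound inv uv)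
    also have "\<dots> \<le> K * B * B * norm (S v - S u)"
      using K B(1) by (intro mult_right_mono mult_mono B(2) uv) auto
    also have "\<dots> \<le> K * B * B * (norm (S v - S u) + norm (S v - S u))"
      using K B(1) by (intro mult_left_mono) auto
    finally show "norm (matrix_inv (S v) - matrix_inv (S u))
        \<le> K * B * B * (norm (S v - S u) + norm (S v - S u))" .
  qed
qed

lemma has_vector_derivative_iff_difference_quotient:
  "(f has_vector_derivative D) (at x within X) \<longleftrightarrow>
    ((\<lambda>y. inverse (y - x) *\<^sub>R (f y - f x)) \<longlongrightarrow> D) (at x within X)"
proof -
  have "(f has_vector_derivative D) (at x within X) \<longleftrightarrow>
      ((\<lambda>y. norm ((1 / norm (y - x)) *\<^sub>R (f y - (f x + (y - x) *\<^sub>R D)))) \<longlongrightarrow> 0) (at x within X)"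
    unfolding has_vector_derivative_def has_derivative_within
    by (simp only: tendsto_norm_zero_iff bounded_linear_scaleR_left simp_thms)
  also have "\<dots> \<longleftrightarrow>
      ((\<lambda>y. norm (inverse (y - x) *\<^sub>R (f y - f x) - D)) \<longlongrightarrow> 0) (at x within X)"
  proof (rule Lim_cong_within)
    fix y assume y: "y \<noteq> x"
    have "f y - (f x + (y - x) *\<^sub>R D) = (f y - f x) - (y - x) *\<^sub>R D"
      by simp
    then have "inverse (y - x) *\<^sub>R (f y - f x) - D = inverse (y - x) *\<^sub>R (f y - (f x + (y - x) *\<^sub>R D))"
      using y by (simp only: scaleR_diff_right) simp
    then show "norm ((1 / norm (y - x)) *\<^sub>R (f y - (f x + (y - x) *\<^sub>R D))) =
        norm (inverse (y - x) *\<^sub>R (f y - f x) - D)"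
      by (simp add: divide_inverse)
  qed auto
  also have "\<dots> \<longleftrightarrow> ((\<lambda>y. inverse (y - x) *\<^sub>R (f y - f x)) \<longlongrightarrow> D) (at x within X)"
    by (simp only: tendsto_norm_zero_iff LIM_zero_iff)
  finally show ?thesis .
qed

text \<open>The difference formula \<open>matrix_inv_diff\<close> writes the difference
  quotient of the inverse as the difference quotient of \<open>S\<close> between two inverses, one of which is
  continuous at \<open>x\<close> and the other constant.\<close>

lemma has_vector_derivative_matrix_inv:
  fixes S :: "real \<Rightarrow> complex^'n^'n"
  assumes S: "(S has_vector_derivative S') (at x within X)"
    and inv: "\<And>x. x \<in> X \<Longrightarrow> invertible (S x)" and x: "x \<in> X"
  shows "((\<lambda>x. matrix_inv (S x)) has_vector_derivative - (matrix_inv (S x) ** S' ** matrix_inv (S x)))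
    (at x within X)"
  unfolding has_vector_derivative_iff_difference_quotient
proof (rule Lim_transform_eventually)
  have M: "((\<lambda>y. matrix_inv (S y)) \<longlongrightarrow> matrix_inv (S x)) (at x within X)"
    using has_vector_derivative_continuous [OF S]
    by (intro tendsto_matrix_inv inv x) (simp_all add: continuous_within)
  show "((\<lambda>y. - (matrix_inv (S y) ** (inverse (y - x) *\<^sub>R (S y - S x)) ** matrix_inv (S x))) \<longlongrightarrow>
      - (matrix_inv (S x) ** S' ** matrix_inv (S x))) (at x within X)"
    using S unfolding has_vector_derivative_iff_difference_quotient
    by (intro tendsto_minus bounded_bilinear.tendsto [OF bounded_bilinear_matrix_mul] M tendsto_const)
  have "- (matrix_inv (S y) ** (inverse (y - x) *\<^sub>R (S y - S x)) ** matrix_inv (S x)) =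
      inverse (y - x) *\<^sub>R (matrix_inv (S y) - matrix_inv (S x))" if "y \<in> X" for y
    by (simp add: matrix_inv_diff [OF inv [OF x] inv [OF that]]
        bounded_bilinear.scaleR_left [OF bounded_bilinear_matrix_mul]
        bounded_bilinear.scaleR_right [OF bounded_bilinear_matrix_mul])
  then show "\<forall>\<^sub>F y in at x within X.
      - (matrix_inv (S y) ** (inverse (y - x) *\<^sub>R (S y - S x)) ** matrix_inv (S x)) =
      inverse (y - x) *\<^sub>R (matrix_inv (S y) - matrix_inv (S x))"
    by (simp add: eventually_at_filter)
qed

section \<open>Calculus of derivatives almost everywhere\<close>

lemma has_ae_derivative_onI:
  assumes "\<And>a b. \<lbrakk>a \<le> b; {a..b} \<subseteq> X\<rbrakk> \<Longrightarrow> abs_continuous a b f"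
    and "AE x\<in>X in lebesgue. (f has_vector_derivative f' x) (at x within X)"
  shows "has_ae_derivative_on f f' X"
  using assms by (simp add: has_ae_derivative_on_def locally_abs_continuous_def)

lemma has_ae_derivative_onD:
  assumes "has_ae_derivative_on f f' X"
  shows "\<And>a b. \<lbrakk>a \<le> b; {a..b} \<subseteq> X\<rbrakk> \<Longrightarrow> abs_continuous a b f"
    and "AE x\<in>X in lebesgue. (f has_vector_derivative f' x) (at x within X)"
  using assms by (simp_all add: has_ae_derivative_on_def locally_abs_continuous_def)

lemma has_ae_derivative_on_cong:
  assumes "has_ae_derivative_on f f' X" and "\<And>x. x \<in> X \<Longrightarrow> f x = g x"
    and "\<And>x. x \<in> X \<Longrightarrow> f' x = g' x"
  shows "has_ae_derivative_on g g' X"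
proof (rule has_ae_derivative_onI)
  fix a b :: real
  assume ab: "a \<le> b" "{a..b} \<subseteq> X"
  note f = has_ae_derivative_onD(1) [OF assms(1) ab]
  show "abs_continuous a b g"
  proof (rule abs_continuous_dominated [OF f f, where C = 1])
    fix u v assume "u \<in> {a..b}" "v \<in> {a..b}"
    then have "f u = g u" "f v = g v"
      using ab assms(2) by blast+
    then show "norm (g v - g u) \<le> 1 * (norm (f v - f u) + norm (f v - f u))"
      by simp
  qed
next
  have eq: "(g has_vector_derivative g' x) (at x within X)"
    if "x \<in> X" "(f has_vector_derivative f' x) (at x within X)" for x
    using has_vector_derivative_transform [OF that(1) _ that(2)] assms(2,3) that(1) by simp
  show "AE x\<in>X in lebesgue. (g has_vector_derivative g' x) (at x within X)"
    using has_ae_derivative_onD(2) [OF assms(1)] 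
    by eventually_elim (use eq in blast)
qed

lemma has_ae_derivative_on_subset:
  assumes "has_ae_derivative_on f f' X" and "Y \<subseteq> X"
  shows "has_ae_derivative_on f f' Y"
proof (rule has_ae_derivative_onI)
  show "abs_continuous a b f" if "a \<le> b" "{a..b} \<subseteq> Y" for a b
    using that assms(2) by (intro has_ae_derivative_onD(1) [OF assms(1)]) auto
  show "AE x\<in>Y in lebesgue. (f has_vector_derivative f' x) (at x within Y)"
    using has_ae_derivative_onD(2) [OF assms(1)]
    by eventually_elim (use assms(2) in \<open>blast intro: has_vector_derivative_within_subset\<close>)
qed

lemma has_ae_derivative_on_const: "has_ae_derivative_on (\<lambda>x. c) (\<lambda>x. 0) X"
proof (rule has_ae_derivative_onI)
  show "abs_continuous a b (\<lambda>x. c)" for a b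
    unfolding abs_continuous_def by (intro allI impI exI [of _ 1]) simp
qed simp

lemma has_ae_derivative_on_add:
  assumes "has_ae_derivative_on f f' X" "has_ae_derivative_on g g' X"
  shows "has_ae_derivative_on (\<lambda>x. f x + g x) (\<lambda>x. f' x + g' x) X"
proof (rule has_ae_derivative_onI)
  show "abs_continuous a b (\<lambda>x. f x + g x)" if "a \<le> b" "{a..b} \<subseteq> X" for a b
    by (rule abs_continuous_add [OF has_ae_derivative_onD(1) [OF assms(1) that]
          has_ae_derivative_onD(1) [OF assms(2) that]])
  show "AE x\<in>X in lebesgue. ((\<lambda>x. f x + g x) has_vector_derivative f' x + g' x) (at x within X)"
    using has_ae_derivative_onD(2) [OF assms(1)] has_ae_derivative_onD(2) [OF assms(2)]
    by eventually_elim (simp add: has_vector_derivative_add)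
qed

lemma has_ae_derivative_on_linear:
  assumes T: "bounded_linear T" and f: "has_ae_derivative_on f f' X"
  shows "has_ae_derivative_on (\<lambda>x. T (f x)) (\<lambda>x. T (f' x)) X"
proof (rule has_ae_derivative_onI)
  show "abs_continuous a b (\<lambda>x. T (f x))" if "a \<le> b" "{a..b} \<subseteq> X" for a b
    by (rule abs_continuous_linear [OF T has_ae_derivative_onD(1) [OF f that]])
  show "AE x\<in>X in lebesgue. ((\<lambda>x. T (f x)) has_vector_derivative T (f' x)) (at x within X)"
    using has_ae_derivative_onD(2) [OF f]
    by eventually_elim (simp add: bounded_linear.has_vector_derivative [OF T])
qed

lemma has_ae_derivative_on_matrix_mul:
  fixes f :: "real \<Rightarrow> complex^'b^'a" and g :: "real \<Rightarrow> complex^'c^'b"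
  assumes f: "has_ae_derivative_on f f' X" and g: "has_ae_derivative_on g g' X"
  shows "has_ae_derivative_on (\<lambda>x. f x ** g x) (\<lambda>x. f x ** g' x + f' x ** g x) X"
proof (rule has_ae_derivative_onI)
  show "abs_continuous a b (\<lambda>x. f x ** g x)" if "a \<le> b" "{a..b} \<subseteq> X" for a b
    by (rule abs_continuous_bilinear [OF bounded_bilinear_matrix_mul
          has_ae_derivative_onD(1) [OF f that] has_ae_derivative_onD(1) [OF g that]])
  show "AE x\<in>X in lebesgue.
      ((\<lambda>x. f x ** g x) has_vector_derivative f x ** g' x + f' x ** g x) (at x within X)"
    using has_ae_derivative_onD(2) [OF f] has_ae_derivative_onD(2) [OF g]
    by eventually_elim (simp add: bounded_bilinear.has_vector_derivative [OF bounded_bilinear_matrix_mul])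
qed

lemma has_ae_derivative_on_matrix_inv:
  fixes S :: "real \<Rightarrow> complex^'n^'n"
  assumes S: "has_ae_derivative_on S S' X" and inv: "\<And>x. x \<in> X \<Longrightarrow> invertible (S x)"
  shows "has_ae_derivative_on (\<lambda>x. matrix_inv (S x))
    (\<lambda>x. - (matrix_inv (S x) ** S' x ** matrix_inv (S x))) X"
proof (rule has_ae_derivative_onI)
  show "abs_continuous a b (\<lambda>x. matrix_inv (S x))" if "a \<le> b" "{a..b} \<subseteq> X" for a b
    using that(2) by (intro abs_continuous_matrix_inv [OF has_ae_derivative_onD(1) [OF S that]] inv) blast
  show "AE x\<in>X in lebesgue. ((\<lambda>x. matrix_inv (S x)) has_vector_derivative
      - (matrix_inv (S x) ** S' x ** matrix_inv (S x))) (at x within X)"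
    using has_ae_derivative_onD(2) [OF S]
    by eventually_elim (use inv in \<open>blast intro: has_vector_derivative_matrix_inv\<close>)
qed

text \<open>On an interval absolute continuity turns a derivative that vanishes almost everywhere into
  constancy; it is what carries identities from one point along the interval.\<close>

lemma has_ae_derivative_on_zero_imp_constant:
  assumes f: "has_ae_derivative_on f f' X" and zero: "\<And>x. x \<in> X \<Longrightarrow> f' x = 0"
    and X: "is_interval X" and xy: "x \<in> X" "y \<in> X"
  shows "f x = f y"
proof -
  have le: "f b = f a" if "a \<in> X" "b \<in> X" "a \<le> b" for a b
  proof -
    have sub: "{a..b} \<subseteq> X"
      by (auto intro: mem_is_interval_1_I [OF X that(1,2)])
    show ?thesis
    proof (rule abs_continuous_null_derivative [OF _ that(3)])
      show "abs_continuous a b f"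
        by (rule has_ae_derivative_onD(1) [OF f that(3) sub])
      show "AE x\<in>{a..b} in lebesgue. (f has_vector_derivative 0) (at x within {a..b})"
        using has_ae_derivative_onD(2) [OF has_ae_derivative_on_subset [OF f sub]]
        by eventually_elim (use zero sub in \<open>metis subsetD\<close>)
    qed
  qed
  show ?thesis
    using le [OF xy] le [OF xy(2,1)] by (cases "x \<le> y") auto
qed

lemma absolutely_integrable_on_matrix_sandwich:
  fixes F :: "real \<Rightarrow> complex^'b^'a" and H :: "real \<Rightarrow> complex^'c^'b" and G :: "real \<Rightarrow> complex^'d^'c"
  assumes F: "continuous_on {a..b} F" and G: "continuous_on {a..b} G"
    and H: "H absolutely_integrable_on {a..b}"
  shows "(\<lambda>x. F x ** H x ** G x) absolutely_integrable_on {a..b}"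
proof -
  have bil: "bilinear ((**) :: complex^'b^'a \<Rightarrow> complex^'c^'b \<Rightarrow> complex^'c^'a)"
    by (simp add: bilinear_conv_bounded_bilinear bounded_bilinear_matrix_mul)
  have bil': "bilinear (\<lambda>(N :: complex^'d^'c) (M :: complex^'c^'a). M ** N)"
    by (simp add: bilinear_conv_bounded_bilinear bounded_bilinear.flip [OF bounded_bilinear_matrix_mul])
  have meas: "F \<in> borel_measurable (lebesgue_on {a..b})" "G \<in> borel_measurable (lebesgue_on {a..b})"
    using F G by (simp_all add: continuous_imp_measurable_on_sets_lebesgue)
  have bdd: "bounded (F ` {a..b})" "bounded (G ` {a..b})"
    using F G by (simp_all add: compact_imp_bounded compact_continuous_image)
  have "(\<lambda>x. F x ** H x) absolutely_integrable_on {a..b}"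
    by (rule absolutely_integrable_bounded_measurable_product [OF bil meas(1) _ bdd(1) H]) simp
  then show ?thesis
    by (rule absolutely_integrable_bounded_measurable_product [OF bil' meas(2) _ bdd(2), rotated]) simp
qed

section \<open>The algebra of the transfer matrix function\<close>

lemma mat_eq_scale: "mat z = z *\<^sub>m mat 1"
  by (simp add: vec_eq_iff mat_def)

lemma resolvent_inverse:
  assumes "z \<notin> mat_spectrum A"
  shows "(A - mat z) ** resolvent A z = mat 1" "resolvent A z ** (A - mat z) = mat 1"
    "A ** resolvent A z = mat 1 + z *\<^sub>m resolvent A z"
    "resolvent A z ** A = mat 1 + z *\<^sub>m resolvent A z"
proof -
  have inv: "invertible (A - mat z)"
    using assms by (simp add: mat_spectrum_def)
  show 1: "(A - mat z) ** resolvent A z = mat 1" "resolvent A z ** (A - mat z) = mat 1"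
    unfolding resolvent_def by (rule matrix_inv_invertible [OF inv])+
  from 1 show "A ** resolvent A z = mat 1 + z *\<^sub>m resolvent A z"
    "resolvent A z ** A = mat 1 + z *\<^sub>m resolvent A z"
    by (simp_all add: matrix_expand mat_eq_scale [of z] algebra_simps)
qed

lemma resolvent_identity:
  assumes z: "z \<notin> mat_spectrum A" and u: "u \<notin> mat_spectrum A"
  shows "resolvent A z - resolvent A u = (z - u) *\<^sub>m (resolvent A z ** resolvent A u)"
proof -
  have "resolvent A z ** A ** resolvent A u = resolvent A u + z *\<^sub>m (resolvent A z ** resolvent A u)"
    unfolding resolvent_inverse(4) [OF z] by (simp add: matrix_expand)
  moreover have "resolvent A z ** A ** resolvent A u
      = resolvent A z + u *\<^sub>m (resolvent A z ** resolvent A u)"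
    unfolding matrix_mul_assoc [symmetric] resolvent_inverse(3) [OF u] by (simp add: matrix_expand)
  ultimately show ?thesis
    by (simp add: vec_eq_iff algebra_simps)
qed

lemma resolvent_ctranspose:
  assumes "z \<notin> mat_spectrum A"
  shows "resolvent (ctranspose A) (cnj z) = ctranspose (resolvent A z)"
    "cnj z \<notin> mat_spectrum (ctranspose A)"
proof -
  have "ctranspose (A - mat z) = ctranspose A - mat (cnj z)"
    by (simp add: ctranspose_linear)
  moreover have "invertible (A - mat z)"
    using assms by (simp add: mat_spectrum_def)
  ultimately show "resolvent (ctranspose A) (cnj z) = ctranspose (resolvent A z)"
    "cnj z \<notin> mat_spectrum (ctranspose A)"
    using ctranspose_matrix_inv [of "A - mat z"] by (simp_all add: resolvent_def mat_spectrum_def)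
qed

text \<open>This computation drives both the invertibility of the transfer function and the
  Darboux equation. The product of the two factors contains \<open>M ** P ** V ** M\<close> between \<open>L\<close> and \<open>R\<close>. The
  hypothesis \<open>id\<close> replaces it by \<open>M ** A - B ** M\<close>, and
  \<open>M ** A - B ** M = M ** (A - z) - (B - u) ** M + (z - u) M\<close>, in which the first two terms cancel
  against a resolvent. They produce the two linear terms of the product with opposite sign, so that a
  single term with the factor \<open>z - u\<close> remains. With \<open>u = z\<close> the factors are inverse to each other; with
  \<open>u\<close> a pole of the system the factor \<open>z - u\<close> cancels the pole.\<close>

lemma transfer_product:
  fixes A B M L R :: "complex^'n^'n" and P :: "complex^'m^'n" and V :: "complex^'n^'m"
  assumes id: "M ** P ** V ** M = (- \<i>) *\<^sub>m (M ** A - B ** M)"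
    and R: "A ** R = mat 1 + z *\<^sub>m R" and L: "L ** B = mat 1 + u *\<^sub>m L"
  shows "(mat 1 + \<i> *\<^sub>m (V ** L ** M ** P)) ** (mat 1 - \<i> *\<^sub>m (V ** M ** R ** P))
    = mat 1 - (\<i> * (z - u)) *\<^sub>m (V ** L ** M ** R ** P)"
proof -
  have "L ** (M ** P ** V ** M) ** R = (- \<i>) *\<^sub>m (L ** M ** (A ** R) - (L ** B) ** M ** R)"
    unfolding id by (simp only: matrix_expand)
  also have "\<dots> = (- \<i>) *\<^sub>m (L ** M - M ** R + (z - u) *\<^sub>m (L ** M ** R))"
    by (simp add: R L matrix_expand) (simp add: vec_eq_iff algebra_simps)
  finally have "V ** (L ** (M ** P ** V ** M) ** R) ** P
      = (- \<i>) *\<^sub>m (V ** L ** M ** P - V ** M ** R ** P + (z - u) *\<^sub>m (V ** L ** M ** R ** P))"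
    by (simp add: matrix_expand)
  then show ?thesis
    by (simp add: matrix_expand) (simp add: vec_eq_iff algebra_simps)
qed

text \<open>The contribution of one pole \<open>u\<close> to the Darboux equation. Both
  \<open>E ** (mat 1 + Y) ** w\<close> and \<open>w ** J ** H\<close> differ from \<open>E\<close> by a multiple of \<open>z - u\<close>, the first by
  \<open>transfer_product\<close> and the second by the resolvent identity, hence their difference is divisible by
  \<open>z - u\<close>.\<close>

lemma darboux_term:
  fixes M L R Rk :: "complex^'n^'n" and P :: "complex^'m^'n" and V :: "complex^'n^'m"
    and J H Y w E :: "complex^'m^'m"
  assumes product: "(mat 1 + Y) ** w = mat 1 - (\<i> * (z - u)) *\<^sub>m (V ** L ** M ** R ** P)"
    and resolvent: "R - Rk = (z - u) *\<^sub>m (R ** Rk)"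
    and w: "w = mat 1 - \<i> *\<^sub>m (V ** M ** R ** P)"
    and E: "E = J ** H - \<i> *\<^sub>m (V ** M ** Rk ** P ** J ** H)" and zu: "z \<noteq> u"
  shows "(\<i> * inverse (z - u)) *\<^sub>m (E ** (mat 1 + Y) ** w - w ** J ** H)
    = E ** V ** L ** M ** R ** P - V ** M ** R ** Rk ** P ** J ** H"
proof -
  have 1: "E ** (mat 1 + Y) ** w = E - (\<i> * (z - u)) *\<^sub>m (E ** V ** L ** M ** R ** P)"
    unfolding matrix_mul_assoc [symmetric, of E "mat 1 + Y"] product by (simp add: matrix_expand)
  have "E - w ** J ** H = \<i> *\<^sub>m (V ** M ** (R - Rk) ** P ** J ** H)"
    unfolding E w by (simp add: matrix_expand) (simp add: vec_eq_iff algebra_simps)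
  also have "\<dots> = (\<i> * (z - u)) *\<^sub>m (V ** M ** R ** Rk ** P ** J ** H)"
    unfolding resolvent by (simp add: matrix_expand) (simp add: vec_eq_iff algebra_simps)
  finally have 2: "w ** J ** H = E - (\<i> * (z - u)) *\<^sub>m (V ** M ** R ** Rk ** P ** J ** H)"
    by (simp add: algebra_simps)
  have "(\<i> * inverse (z - u)) *\<^sub>m
      ((E - (\<i> * (z - u)) *\<^sub>m T1) - (E - (\<i> * (z - u)) *\<^sub>m T2)) = T1 - T2"
    for T1 T2 :: "complex^'m^'m"
  proof -
    have "\<i> * inverse (z - u) * (e - \<i> * (z - u) * s - (e - \<i> * (z - u) * t)) = s - t" for e s t
      using zu by (simp add: field_simps)
    then show ?thesis
      by (simp add: vec_eq_iff)
  qed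
  then show ?thesis
    unfolding 1 2 .
qed

section \<open>Fundamental solutions and Darboux matrices\<close>

text \<open>The quotient \<open>V\<^sup>-\<^sup>1 W\<close> of two fundamental solutions has derivative
  \<open>V\<^sup>-\<^sup>1 G W - V\<^sup>-\<^sup>1 G V V\<^sup>-\<^sup>1 W = 0\<close>, so it is constant.\<close>

lemma fundamental_solution_unique:
  fixes V W :: "real \<Rightarrow> complex^'m^'m"
  assumes V: "fundamental_solution X G V" and W: "fundamental_solution X G W"
    and X: "is_interval X" "x0 \<in> X"
  shows "\<exists>C. invertible C \<and> (\<forall>x\<in>X. W x = V x ** C)"
proof -
  have inv: "invertible (V x)" "invertible (W x)" if "x \<in> X" for x
    using V W that by (simp_all add: fundamental_solution_def)
  have dV: "has_ae_derivative_on V (\<lambda>x. G x ** V x) X"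
    and dW: "has_ae_derivative_on W (\<lambda>x. G x ** W x) X"
    using V W by (simp_all add: fundamental_solution_def)
  define f where "f x = matrix_inv (V x) ** W x" for x
  have "has_ae_derivative_on f (\<lambda>x. matrix_inv (V x) ** (G x ** W x)
      + - (matrix_inv (V x) ** (G x ** V x) ** matrix_inv (V x)) ** W x) X"
    unfolding f_def by (rule has_ae_derivative_on_matrix_mul [OF has_ae_derivative_on_matrix_inv [OF dV inv(1)] dW])
  moreover have "matrix_inv (V x) ** (G x ** W x)
      + - (matrix_inv (V x) ** (G x ** V x) ** matrix_inv (V x)) ** W x = 0" if "x \<in> X" for x
  proof -
    have "matrix_inv (V x) ** (G x ** V x) ** matrix_inv (V x) ** W x
        = matrix_inv (V x) ** G x ** (V x ** matrix_inv (V x)) ** W x"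
      by (simp only: matrix_mul_assoc)
    then show ?thesis
      by (simp add: matrix_inv_invertible inv that matrix_mul_assoc matrix_mul_minus_left)
  qed
  ultimately have const: "f x = f x0" if "x \<in> X" for x
    using X that by (intro has_ae_derivative_on_zero_imp_constant)
  have "W x = V x ** f x0" if "x \<in> X" for x
    using matrix_inv_invertible(1) [OF inv(1) [OF that]] const [OF that, symmetric]
    by (simp add: f_def matrix_mul_assoc)
  moreover have "invertible (f x0)"
    unfolding f_def using inv [OF X(2)] matrix_inv_eqI(2) [OF matrix_inv_invertible(2)]
    by (intro invertible_mult) auto
  ultimately show ?thesis by blast
qed

lemma fundamental_solution_darboux:
  fixes W :: "real \<Rightarrow> complex^'m^'m"
  assumes dW: "has_ae_derivative_on W (\<lambda>x. Gt x ** W x - W x ** G x) X"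
    and inv: "\<And>x. x \<in> X \<Longrightarrow> invertible (W x)" and w: "fundamental_solution X G w"
  shows "fundamental_solution X Gt (\<lambda>x. W x ** w x)"
proof -
  have dw: "has_ae_derivative_on w (\<lambda>x. G x ** w x) X"
    using w by (simp add: fundamental_solution_def)
  have "has_ae_derivative_on (\<lambda>x. W x ** w x) (\<lambda>x. Gt x ** (W x ** w x)) X"
    by (rule has_ae_derivative_on_cong [OF has_ae_derivative_on_matrix_mul [OF dW dw]])
      (simp_all add: matrix_expand)
  then show ?thesis
    using w inv by (simp add: fundamental_solution_def invertible_mult)
qed

section \<open>The transformation determined by a triple\<close>

text \<open>The signature matrix is a self-adjoint involution; the transformation is developed for any such \<open>j\<close>.\<close>

locale gbdt =
  fixes r :: nat and c :: "nat \<Rightarrow> real" and j :: "complex^'m^'m"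
    and \<beta> :: "nat \<Rightarrow> real \<Rightarrow> complex^'m^'p" and H :: "nat \<Rightarrow> real \<Rightarrow> complex^'m^'m"
    and I :: "real set" and A :: "complex^'n^'n" and S :: "real \<Rightarrow> complex^'n^'n"
    and P :: "real \<Rightarrow> complex^'m^'n"
  assumes j_square: "j ** j = mat 1" and j_adjoint: "ctranspose j = j"
    and interval: "is_interval I" "0 \<in> I"
    and H: "hamiltonians r I \<beta> H"
    and poles: "\<And>k. k \<in> {1..r} \<Longrightarrow> complex_of_real (c k) \<notin> mat_spectrum A"
    and triple: "gbdt_triple r c j H I A S P"
begin

abbreviation "R k \<equiv> resolvent A (complex_of_real (c k))"

abbreviation "L k \<equiv> resolvent (ctranspose A) (complex_of_real (c k))"

abbreviation "V x \<equiv> j ** ctranspose (P x)"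

abbreviation "M x \<equiv> matrix_inv (S x)"

definition regular_points :: "real set" where "regular_points = {x \<in> I. invertible (S x)}"

lemma j_square_mul: "N ** j ** j = N"
  by (simp add: j_square flip: matrix_mul_assoc)

lemma H_adjoint: "ctranspose (H k x) = H k x" if "k \<in> {1..r}" "x \<in> I"
  using H that by (simp add: hamiltonians_def ctranspose_mul)

lemma L_eq: "L k = ctranspose (R k)" if "k \<in> {1..r}"
  using resolvent_ctranspose(1) [OF poles [OF that]] by simp

lemma R_mul: "A ** R k = mat 1 + c k *\<^sub>m R k" if "k \<in> {1..r}"
  using resolvent_inverse(3) [OF poles [OF that]] .

lemma L_mul: "L k ** ctranspose A = mat 1 + c k *\<^sub>m L k" if "k \<in> {1..r}"
proof -
  have "ctranspose (A ** R k) = ctranspose (mat 1 + c k *\<^sub>m R k)"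
    by (simp only: R_mul [OF that])
  then show ?thesis
    by (simp add: L_eq [OF that] ctranspose_mul ctranspose_linear ctranspose_scale)
qed

definition dP :: "real \<Rightarrow> complex^'m^'n"
  where "dP x = - (\<i> *\<^sub>m (\<Sum>k=1..r. R k ** P x ** j ** H k x))"

definition dS :: "real \<Rightarrow> complex^'n^'n"
  where "dS x = - (\<Sum>k=1..r. R k ** P x ** j ** H k x ** V x ** L k)"

text \<open>This is \<open>j\<close> times the adjoint of \<open>dP x\<close>: on the interval \<open>H k x\<close> is
  self-adjoint and the adjoint of \<open>R k\<close> is \<open>L k\<close>.\<close>

definition dV :: "real \<Rightarrow> complex^'n^'m"
  where "dV x = \<i> *\<^sub>m (\<Sum>k=1..r. j ** H k x ** V x ** L k)"

lemma P_derivative: "has_ae_derivative_on P dP I"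
  using triple by (simp add: gbdt_triple_def dP_def [abs_def])

lemma S_derivative: "has_ae_derivative_on S dS I"
  using triple by (simp add: gbdt_triple_def dS_def [abs_def] matrix_mul_assoc)

lemma V_derivative: "has_ae_derivative_on V dV I"
proof (rule has_ae_derivative_on_cong)
  show "has_ae_derivative_on V (\<lambda>x. j ** ctranspose (dP x)) I"
    by (rule has_ae_derivative_on_linear [OF bounded_linear_compose
          [OF bounded_linear_matrix_mul_right bounded_linear_ctranspose] P_derivative])
  show "j ** ctranspose (dP x) = dV x" if "x \<in> I" for x
  proof -
    have "ctranspose (dP x) = \<i> *\<^sub>m (\<Sum>k=1..r. H k x ** V x ** L k)"
      unfolding dP_def by (simp add: ctranspose_linear ctranspose_scale ctranspose_mul H_adjoint
          L_eq j_adjoint that matrix_mul_assoc) (simp add: vec_eq_iff)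
    then show ?thesis
      by (simp add: dV_def matrix_expand)
  qed
qed simp

lemma dS_adjoint: "ctranspose (dS x) = dS x" if "x \<in> I"
  unfolding dS_def
  by (simp add: ctranspose_linear ctranspose_mul H_adjoint L_eq j_adjoint that matrix_mul_assoc)

text \<open>The equation for \<open>S\<close> has a self-adjoint right-hand side, because the parameters
  \<open>c k\<close> are real and the Hamiltonians are self-adjoint, so \<open>S - S\<^sup>*\<close> keeps its initial value \<open>0\<close>.\<close>

lemma S_adjoint: "ctranspose (S x) = S x" if "x \<in> I"
proof -
  have "S x - ctranspose (S x) = S 0 - ctranspose (S 0)"
  proof (rule has_ae_derivative_on_zero_imp_constant [OF _ _ interval(1) that interval(2)])
    show "has_ae_derivative_on (\<lambda>x. S x - ctranspose (S x)) (\<lambda>x. dS x - ctranspose (dS x)) I"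
      by (rule has_ae_derivative_on_linear [OF bounded_linear_sub
            [OF bounded_linear_ident bounded_linear_ctranspose] S_derivative])
  qed (simp add: dS_adjoint)
  also have "\<dots> = 0"
    using triple by (simp add: gbdt_triple_def)
  finally show ?thesis by simp
qed

text \<open>The identity that the triple satisfies at \<open>0\<close> propagates along the interval. In
  the derivative of its left-hand side, \<open>A ** R k\<close> and \<open>L k ** ctranspose A\<close> are \<open>mat 1\<close> plus the same
  multiple of \<open>R k\<close> and of \<open>L k\<close>. The multiples cancel, and what remains is the derivative of the
  right-hand side.\<close>

lemma matrix_identity: "A ** S x - S x ** ctranspose A = \<i> *\<^sub>m (P x ** V x)" if "x \<in> I"
proof -
  let ?T = "\<lambda>N. A ** N - N ** ctranspose A"
  let ?U = "\<lambda>N :: complex^'n^'n. (- \<i>) *\<^sub>m N"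
  have "?T (S x) + ?U (P x ** V x) = ?T (S 0) + ?U (P 0 ** V 0)"
  proof (rule has_ae_derivative_on_zero_imp_constant [OF _ _ interval(1) that interval(2)])
    show "has_ae_derivative_on (\<lambda>x. ?T (S x) + ?U (P x ** V x))
        (\<lambda>x. ?T (dS x) + ?U (P x ** dV x + dP x ** V x)) I"
      by (intro has_ae_derivative_on_add has_ae_derivative_on_linear [where T = ?T]
          has_ae_derivative_on_linear [where T = ?U] has_ae_derivative_on_matrix_mul
          S_derivative P_derivative V_derivative bounded_linear_cmat_scale bounded_linear_sub
          bounded_linear_matrix_mul_left bounded_linear_matrix_mul_right)
    fix x assume x: "x \<in> I"
    have T: "?T (dS x) = (\<Sum>k=1..r. R k ** P x ** j ** H k x ** V x - P x ** j ** H k x ** V x ** L k)"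
    proof -
      have "?T (dS x) = (\<Sum>k=1..r. R k ** P x ** j ** H k x ** V x ** (L k ** ctranspose A)
          - (A ** R k) ** P x ** j ** H k x ** V x ** L k)"
        unfolding dS_def by (simp add: matrix_expand sum_subtractf)
      also have "\<dots> = (\<Sum>k=1..r. R k ** P x ** j ** H k x ** V x - P x ** j ** H k x ** V x ** L k)"
        by (intro sum.cong refl) (simp add: R_mul L_mul matrix_expand)
      finally show ?thesis .
    qed
    have "?U (P x ** dV x) = (\<Sum>k=1..r. P x ** j ** H k x ** V x ** L k)"
      unfolding dV_def by (simp add: matrix_expand) (simp add: vec_eq_iff)
    moreover have "?U (dP x ** V x) = - (\<Sum>k=1..r. R k ** P x ** j ** H k x ** V x)"
      unfolding dP_def by (simp add: matrix_expand) (simp add: vec_eq_iff)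
    moreover have "?U (P x ** dV x + dP x ** V x) = ?U (P x ** dV x) + ?U (dP x ** V x)"
      by (simp add: vec_eq_iff algebra_simps)
    ultimately show "?T (dS x) + ?U (P x ** dV x + dP x ** V x) = 0"
      unfolding T by (simp add: sum_subtractf)
  qed
  also have "\<dots> = 0"
    using triple by (simp add: gbdt_triple_def matrix_mul_assoc) (simp add: vec_eq_iff)
  finally show ?thesis
    by (simp add: vec_eq_iff)
qed

lemma M_adjoint: "ctranspose (M x) = M x" if "x \<in> regular_points"
  using that ctranspose_matrix_inv(1) [of "S x"] S_adjoint [of x] by (simp add: regular_points_def)

text \<open>Multiplying the matrix identity by the inverse of \<open>S x\<close> on both sides gives the
  form that \<open>transfer_product\<close> needs.\<close>

lemma inverse_identity: "M x ** P x ** V x ** M x = (- \<i>) *\<^sub>m (M x ** A - ctranspose A ** M x)"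
  if "x \<in> regular_points"
proof -
  have x: "x \<in> I" and inv: "invertible (S x)"
    using that by (simp_all add: regular_points_def)
  have "M x ** (\<i> *\<^sub>m (P x ** V x)) ** M x
      = M x ** A ** (S x ** M x) - (M x ** S x) ** ctranspose A ** M x"
    unfolding matrix_identity [OF x, symmetric] by (simp only: matrix_expand)
  then have eq: "\<i> *\<^sub>m (M x ** P x ** V x ** M x) = M x ** A - ctranspose A ** M x"
    by (simp add: matrix_inv_invertible inv matrix_expand)
  show ?thesis
    unfolding eq [symmetric] by (simp add: vec_eq_iff)
qed

lemma transfer_eq: "w_transfer j A S P x z = mat 1 - \<i> *\<^sub>m (V x ** M x ** resolvent A z ** P x)"
  by (simp add: w_transfer_def)

lemma gbdt_Y_eq: "gbdt_Y c j A S P k x = \<i> *\<^sub>m (V x ** L k ** M x ** P x)"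
  by (simp add: gbdt_Y_def)

lemma gbdt_X_eq: "gbdt_X c j A S P k x = \<i> *\<^sub>m (V x ** M x ** R k ** P x)"
  by (simp add: gbdt_X_def)

lemma gbdt_H_factor:
  "gbdt_H c j H A S P k x
    = (mat 1 - j ** gbdt_X c j A S P k x ** j) ** H k x ** (mat 1 + gbdt_Y c j A S P k x)"
  by (simp add: gbdt_H_def Let_def matrix_expand)

lemma j_gbdt_H: "j ** gbdt_H c j H A S P k x
    = (j ** H k x - \<i> *\<^sub>m (V x ** M x ** R k ** P x ** j ** H k x)) ** (mat 1 + gbdt_Y c j A S P k x)"
  unfolding gbdt_H_factor gbdt_X_eq by (simp add: matrix_expand j_square)

lemma invertible_transfer:
  assumes x: "x \<in> regular_points" and z: "z \<notin> mat_spectrum A" "z \<notin> mat_spectrum (ctranspose A)"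
  shows "invertible (w_transfer j A S P x z)"
proof -
  have "(mat 1 + \<i> *\<^sub>m (V x ** resolvent (ctranspose A) z ** M x ** P x)) ** w_transfer j A S P x z
      = mat 1 - (\<i> * (z - z)) *\<^sub>m (V x ** resolvent (ctranspose A) z ** M x ** resolvent A z ** P x)"
    unfolding transfer_eq
    by (rule transfer_product [OF inverse_identity [OF x] resolvent_inverse(3) [OF z(1)]
          resolvent_inverse(4) [OF z(2)]])
  also have "\<dots> = mat 1"
    by (simp add: vec_eq_iff)
  finally show ?thesis
    using invertible_left_inverse by blast
qed

text \<open>Since \<open>M x\<close> is self-adjoint and \<open>c k\<close> is real, the adjoint of
  \<open>j P\<^sup>* M R\<^sub>k P\<close> is \<open>P\<^sup>* L\<^sub>k M P j\<close>. Conjugation by \<open>j\<close> moves the last factor \<open>j\<close> to the front, which turns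
  the adjoint of the transfer function at \<open>c k\<close> into \<open>mat 1 + Y\<close>.\<close>

lemma gbdt_beta_eq:
  assumes k: "k \<in> {1..r}" and x: "x \<in> regular_points"
  shows "gbdt_beta c j \<beta> A S P k x = \<beta> k x ** (mat 1 + gbdt_Y c j A S P k x)"
proof -
  have "j ** ctranspose (w_transfer j A S P x (c k)) ** j = mat 1 + gbdt_Y c j A S P k x"
    unfolding transfer_eq gbdt_Y_eq L_eq [OF k]
    by (simp add: ctranspose_linear ctranspose_scale ctranspose_mul M_adjoint [OF x] j_adjoint matrix_expand
        j_square j_square_mul) (simp add: vec_eq_iff)
  then show ?thesis
    by (simp add: gbdt_beta_def flip: matrix_mul_assoc)
qed

text \<open>The two outer factors in \<open>gbdt_H_factor\<close> are adjoint to each other.\<close>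

lemma gbdt_H_eq_beta:
  assumes k: "k \<in> {1..r}" and x: "x \<in> regular_points"
  shows "gbdt_H c j H A S P k x
    = ctranspose (gbdt_beta c j \<beta> A S P k x) ** gbdt_beta c j \<beta> A S P k x"
proof -
  have xI: "x \<in> I"
    using x by (simp add: regular_points_def)
  have "ctranspose (mat 1 + gbdt_Y c j A S P k x) = mat 1 - j ** gbdt_X c j A S P k x ** j"
    unfolding gbdt_X_eq gbdt_Y_eq L_eq [OF k]
    by (simp add: ctranspose_linear ctranspose_scale ctranspose_mul M_adjoint [OF x] j_adjoint matrix_expand
        j_square j_square_mul) (simp add: vec_eq_iff)
  moreover have "H k x = ctranspose (\<beta> k x) ** \<beta> k x"
    using H k xI by (simp add: hamiltonians_def)
  ultimately show ?thesis
    by (simp add: gbdt_H_factor gbdt_beta_eq [OF k x] ctranspose_mul matrix_mul_assoc)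
qed

text \<open>The factors around \<open>H k\<close> in \<open>gbdt_H_factor\<close> are continuous on compact
  subintervals, hence bounded there, and preserve summability.\<close>

lemma hamiltonians_gbdt: "hamiltonians r regular_points (gbdt_beta c j \<beta> A S P) (gbdt_H c j H A S P)"
  unfolding hamiltonians_def
proof (intro ballI conjI)
  fix k assume k: "k \<in> {1..r}"
  show "gbdt_H c j H A S P k x
      = ctranspose (gbdt_beta c j \<beta> A S P k x) ** gbdt_beta c j \<beta> A S P k x" if "x \<in> regular_points" for x
    by (rule gbdt_H_eq_beta [OF k that])
  show "locally_summable regular_points (gbdt_H c j H A S P k)"
    unfolding locally_summable_def
  proof (intro allI impI)
    fix a b assume ab: "a \<le> b \<and> {a..b} \<subseteq> regular_points"
    then have sub: "{a..b} \<subseteq> I" and inv: "\<And>x. x \<in> {a..b} \<Longrightarrow> invertible (S x)"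
      by (auto simp: regular_points_def)
    have P: "continuous_on {a..b} P" and V: "continuous_on {a..b} V" and S: "continuous_on {a..b} S"
      using ab sub P_derivative V_derivative S_derivative
      by (auto intro!: abs_continuous_imp_continuous_on intro: has_ae_derivative_onD(1))
    note mul = bounded_bilinear.continuous_on [OF bounded_bilinear_matrix_mul]
    note scale = bounded_linear.continuous_on [OF bounded_linear_cmat_scale]
    have M: "continuous_on {a..b} M"
      by (rule continuous_on_matrix_inv [OF S inv])
    have "(\<lambda>x. (mat 1 - j ** gbdt_X c j A S P k x ** j) ** H k x ** (mat 1 + gbdt_Y c j A S P k x))
        absolutely_integrable_on {a..b}"
    proof (rule absolutely_integrable_on_matrix_sandwich)
      show "continuous_on {a..b} (\<lambda>x. mat 1 - j ** gbdt_X c j A S P k x ** j)"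
        unfolding gbdt_X_eq by (intro continuous_on_diff mul scale continuous_on_const P V M)
      show "continuous_on {a..b} (\<lambda>x. mat 1 + gbdt_Y c j A S P k x)"
        unfolding gbdt_Y_eq by (intro continuous_on_add mul scale continuous_on_const P V M)
      show "H k absolutely_integrable_on {a..b}"
        using H k ab sub by (simp add: hamiltonians_def locally_summable_def)
    qed
    then show "gbdt_H c j H A S P k absolutely_integrable_on {a..b}"
      by (simp add: gbdt_H_factor [abs_def])
  qed
qed

text \<open>Differentiating \<open>V ** M ** resolvent A z ** P\<close> by the product rule gives three sums
  over the poles. The derivatives of \<open>V\<close> and of \<open>M\<close> combine to the terms with the left factor \<open>E k\<close>, and the
  derivative of \<open>P\<close> gives the others. By \<open>darboux_term\<close>, pole by pole, this is the right-hand side of the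
  Darboux equation.\<close>

lemma transfer_derivative:
  assumes z: "z \<notin> mat_spectrum A" and zc: "\<And>k. k \<in> {1..r} \<Longrightarrow> z \<noteq> c k"
  shows "has_ae_derivative_on (\<lambda>x. w_transfer j A S P x z)
    (\<lambda>x. gbdt_coeff r c j H A S P x z ** w_transfer j A S P x z
      - w_transfer j A S P x z ** system_coeff r c j H x z) regular_points"
proof (rule has_ae_derivative_on_cong)
  have sub: "regular_points \<subseteq> I"
    by (auto simp: regular_points_def)
  note dX = has_ae_derivative_on_subset [OF _ sub]
  let ?T = "\<lambda>N. N ** resolvent A z"
  let ?U = "\<lambda>N :: complex^'m^'m. (- \<i>) *\<^sub>m N"
  show "has_ae_derivative_on (\<lambda>x. mat 1 + ?U (?T (V x ** M x) ** P x))
      (\<lambda>x. 0 + ?U (?T (V x ** M x) ** dP x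
        + ?T (V x ** - (M x ** dS x ** M x) + dV x ** M x) ** P x)) regular_points"
    by (intro has_ae_derivative_on_add has_ae_derivative_on_const
        has_ae_derivative_on_linear [where T = ?U] has_ae_derivative_on_matrix_mul
        has_ae_derivative_on_linear [where T = ?T] has_ae_derivative_on_matrix_inv
        dX [OF P_derivative] dX [OF V_derivative] dX [OF S_derivative]
        bounded_linear_cmat_scale bounded_linear_matrix_mul_left) (simp add: regular_points_def)
  show "mat 1 + ?U (?T (V x ** M x) ** P x) = w_transfer j A S P x z" for x
    by (simp add: transfer_eq vec_eq_iff)
  fix x assume x: "x \<in> regular_points"
  define w where "w = w_transfer j A S P x z"
  define E where "E k = j ** H k x - \<i> *\<^sub>m (V x ** M x ** R k ** P x ** j ** H k x)" for k
  let ?Y = "\<lambda>k. gbdt_Y c j A S P k x"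
  let ?Z = "resolvent A z"
  have "0 + ?U (?T (V x ** M x) ** dP x
        + ?T (V x ** - (M x ** dS x ** M x) + dV x ** M x) ** P x)
      = (\<Sum>k=1..r. E k ** V x ** L k ** M x ** ?Z ** P x - V x ** M x ** ?Z ** R k ** P x ** j ** H k x)"
  proof -
    have 1: "?U (?T (V x ** M x) ** dP x) = (\<Sum>k=1..r. - (V x ** M x ** ?Z ** R k ** P x ** j ** H k x))"
      unfolding dP_def by (simp add: matrix_expand) (simp add: vec_eq_iff sum_negf)
    have 2: "?U (?T (V x ** - (M x ** dS x ** M x)) ** P x)
        = (\<Sum>k=1..r. - (\<i> *\<^sub>m (V x ** M x ** R k ** P x ** j ** H k x ** V x ** L k ** M x ** ?Z ** P x)))"
      unfolding dS_def by (simp add: matrix_expand) (simp add: vec_eq_iff sum_negf sum_distrib_left)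
    have 3: "?U (?T (dV x ** M x) ** P x) = (\<Sum>k=1..r. j ** H k x ** V x ** L k ** M x ** ?Z ** P x)"
      unfolding dV_def by (simp add: matrix_expand) (simp add: vec_eq_iff)
    have "0 + ?U (?T (V x ** M x) ** dP x
        + ?T (V x ** - (M x ** dS x ** M x) + dV x ** M x) ** P x)
      = ?U (?T (V x ** M x) ** dP x) + (?U (?T (V x ** - (M x ** dS x ** M x)) ** P x)
        + ?U (?T (dV x ** M x) ** P x))"
      unfolding matrix_mul_add_left by (simp add: vec_eq_iff algebra_simps)
    also have "\<dots> = (\<Sum>k=1..r. E k ** V x ** L k ** M x ** ?Z ** P x
        - V x ** M x ** ?Z ** R k ** P x ** j ** H k x)"
      unfolding 1 2 3 sum.distrib [symmetric] E_def
      by (intro sum.cong refl) (simp add: matrix_expand)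
    finally show ?thesis .
  qed
  also have "\<dots> = (\<Sum>k=1..r. (\<i> * inverse (z - c k)) *\<^sub>m (E k ** (mat 1 + ?Y k) ** w - w ** j ** H k x))"
  proof (rule sum.cong [OF refl])
    fix k assume k: "k \<in> {1..r}"
    have "(mat 1 + ?Y k) ** w
        = mat 1 - (\<i> * (z - c k)) *\<^sub>m (V x ** L k ** M x ** ?Z ** P x)"
      unfolding w_def transfer_eq gbdt_Y_eq
      by (rule transfer_product [OF inverse_identity [OF x] resolvent_inverse(3) [OF z] L_mul [OF k]])
    then show "E k ** V x ** L k ** M x ** ?Z ** P x - V x ** M x ** ?Z ** R k ** P x ** j ** H k x
        = (\<i> * inverse (z - c k)) *\<^sub>m (E k ** (mat 1 + ?Y k) ** w - w ** j ** H k x)"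
      by (rule darboux_term [OF _ resolvent_identity [OF z poles [OF k]] _ _ zc [OF k], symmetric])
        (simp_all add: w_def transfer_eq E_def)
  qed
  also have "\<dots> = gbdt_coeff r c j H A S P x z ** w - w ** system_coeff r c j H x z"
    unfolding gbdt_coeff_def system_coeff_def j_gbdt_H E_def [symmetric]
    by (simp add: matrix_mul_scale_left matrix_mul_scale_right matrix_mul_sum_left
        matrix_mul_sum_right matrix_mul_assoc)
      (simp add: vec_eq_iff sum_distrib_left sum_subtractf algebra_simps)
  finally show "0 + ?U (?T (V x ** M x) ** dP x
        + ?T (V x ** - (M x ** dS x ** M x) + dV x ** M x) ** P x)
      = gbdt_coeff r c j H A S P x z ** w_transfer j A S P x z
        - w_transfer j A S P x z ** system_coeff r c j H x z"
    unfolding w_def .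
qed

end

section \<open>The transformed system\<close>

theorem theorem3p2:
  fixes r m1 m2 :: nat and c :: "nat \<Rightarrow> real" and I :: "real set"
    and j :: "complex^'m::{finite,linorder}^'m::{finite,linorder}"
    and \<beta> :: "nat \<Rightarrow> real \<Rightarrow> complex^'m::{finite,linorder}^'p"
    and H :: "nat \<Rightarrow> real \<Rightarrow> complex^'m::{finite,linorder}^'m::{finite,linorder}"
    and A :: "complex^'n^'n" and S :: "real \<Rightarrow> complex^'n^'n"
    and P :: "real \<Rightarrow> complex^'m::{finite,linorder}^'n"
    and G Gt wA :: "real \<Rightarrow> complex \<Rightarrow> complex^'m::{finite,linorder}^'m::{finite,linorder}"
    and poles :: "complex set" and X :: "real set"
  assumes r: "r \<ge> 1"
    and c: "inj_on c {1..r}"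
    and m: "CARD('m) = m1 + m2"
    and j_def: "j = signature_mat m1"
    and p: "CARD('p) \<le> CARD('m)"
    and I: "is_interval I" "0 \<in> I"
    and H: "hamiltonians r I \<beta> H"
    and G_def: "G = system_coeff r c j H"
    and poles_def: "poles = (\<lambda>k. of_real (c k)) ` {1..r}"
    and spec: "poles \<inter> mat_spectrum A = {}"
    and triple: "gbdt_triple r c j H I A S P"
    and wA_def: "wA = w_transfer j A S P"
    and Gt_def: "Gt = gbdt_coeff r c j H A S P"
    and X_def: "X = {x \<in> I. invertible (S x)}"
  shows
    "hamiltonians r X (gbdt_beta c j \<beta> A S P) (gbdt_H c j H A S P) \<and>
     (\<forall>x\<in>X. \<forall>z. Gt x z = system_coeff r c j
        (\<lambda>k x. ctranspose (gbdt_beta c j \<beta> A S P k x) ** gbdt_beta c j \<beta> A S P k x) x z) \<and>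
     darboux_matrix X (- (poles \<union> mat_spectrum A \<union> mat_spectrum (ctranspose A))) G Gt wA \<and>
     (\<forall>z. z \<notin> poles \<union> mat_spectrum A \<longrightarrow>
        has_ae_derivative_on (\<lambda>x. wA x z) (\<lambda>x. Gt x z ** wA x z - wA x z ** G x z) X) \<and>
     ((\<forall>x\<in>I. invertible (S x)) \<longrightarrow>
        (\<forall>z w. z \<notin> poles \<union> mat_spectrum A \<union> mat_spectrum (ctranspose A) \<and>
            fundamental_solution I (\<lambda>x. G x z) w \<longrightarrow>
          fundamental_solution I (\<lambda>x. Gt x z) (\<lambda>x. wA x z ** w x) \<and>
          (\<forall>wt. fundamental_solution I (\<lambda>x. Gt x z) wt \<longrightarrow>
             (\<exists>C. invertible C \<and> (\<forall>x\<in>I. wt x = wA x z ** w x ** C)))))"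
proof -
  interpret gbdt r c j \<beta> H I A S P
  proof
    show "complex_of_real (c k) \<notin> mat_spectrum A" if "k \<in> {1..r}" for k
      using spec that unfolding poles_def by blast
    show "j ** j = mat 1" "ctranspose j = j"
      by (simp_all add: j_def signature_mat_square ctranspose_signature_mat)
  qed (fact I H triple)+
  have X: "X = regular_points"
    unfolding X_def regular_points_def ..
  have system: "Gt x z = system_coeff r c j
      (\<lambda>k x. ctranspose (gbdt_beta c j \<beta> A S P k x) ** gbdt_beta c j \<beta> A S P k x) x z"
    if "x \<in> X" for x z
    using that unfolding Gt_def gbdt_coeff_def system_coeff_def X by (simp add: gbdt_H_eq_beta)
  have derivative: "has_ae_derivative_on (\<lambda>x. wA x z) (\<lambda>x. Gt x z ** wA x z - wA x z ** G x z) X"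
    if "z \<notin> poles \<union> mat_spectrum A" for z
    using that unfolding wA_def Gt_def G_def X poles_def by (intro transfer_derivative) auto
  have invertible: "invertible (wA x z)"
    if "x \<in> X" "z \<notin> mat_spectrum A \<union> mat_spectrum (ctranspose A)" for x z
    using that unfolding wA_def X by (intro invertible_transfer) auto
  have fundamental: "fundamental_solution I (\<lambda>x. Gt x z) (\<lambda>x. wA x z ** w x)"
    if "\<forall>x\<in>I. invertible (S x)" "z \<notin> poles \<union> mat_spectrum A \<union> mat_spectrum (ctranspose A)"
      "fundamental_solution I (\<lambda>x. G x z) w" for z w
  proof -
    have "X = I"
      using that(1) by (auto simp: X_def)
    then show ?thesis
      using derivative [of z] invertible [of _ z] that(2,3)
      by (intro fundamental_solution_darboux) auto
  qed
  show ?thesis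
  proof (intro conjI ballI allI impI)
    show "hamiltonians r X (gbdt_beta c j \<beta> A S P) (gbdt_H c j H A S P)"
      unfolding X by (rule hamiltonians_gbdt)
    show "darboux_matrix X (- (poles \<union> mat_spectrum A \<union> mat_spectrum (ctranspose A))) G Gt wA"
      unfolding darboux_matrix_def using derivative invertible by simp
    fix z w wt
    assume S: "\<forall>x\<in>I. invertible (S x)"
      and w: "z \<notin> poles \<union> mat_spectrum A \<union> mat_spectrum (ctranspose A) \<and>
        fundamental_solution I (\<lambda>x. G x z) w"
    then show "fundamental_solution I (\<lambda>x. Gt x z) (\<lambda>x. wA x z ** w x)"
      by (intro fundamental) auto
    then show "\<exists>C. invertible C \<and> (\<forall>x\<in>I. wt x = wA x z ** w x ** C)"
      if "fundamental_solution I (\<lambda>x. Gt x z) wt"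
      using fundamental_solution_unique [OF _ that I] by simp
  qed (use system derivative in auto)
qed

end
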